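(* Let $X$ be an infinite-dimensional complex Banach space and $T\in L(X)$. Then $\sigma_e(T)\subseteq\sigma_{ub}(T)$ if and only if $\sigma_{bf}(T)\subseteq\sigma_{ld}(T)$. Furthermore, $\sigma_{ub}(T)=\sigma_e(T)$ if and only if $\sigma_{ld}(T)=\sigma_{bf}(T)$.
   Context: For $S\in L(X)$: $\alpha(S)=\dim\mathcal N(S)$, $\beta(S)=\operatorname{codim}\mathcal R(S)$, ascent $p(S)=\inf\{n:\mathcal N(S^n)=\mathcal N(S^{n+1})\}$ ($\inf\emptyset=\infty$). $S$ is upper semi-Fredholm if $\mathcal R(S)$ is closed and $\alpha(S)<\infty$; Fredholm if moreover $\beta(S)<\infty$; upper semi-Browder if upper semi-Fredholm with $p(S)<\infty$. $S_{[n]}$ is the restriction of $S$ to $\mathcal R(S^n)$; $S$ is B-Fredholm if for some $n$, $\mathcal R(S^n)$ is closed and $S_{[n]}$ is Fredholm. $\sigma_e(T)$, $\sigma_{ub}(T)$, $\sigma_{bf}(T)$: sets of $\lambda$ with $T-\lambda I$ not Fredholm, not upper semi-Browder, not B-Fredholm. $\sigma_{ld}(T)$ (left Drazin spectrum) is the set of $\lambda$ for which it is not the case that $p=p(T-\lambda I)<\infty$ and $\mathcal R((T-\lambda I)^{p+1})$ is closed. *)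

theory Defs
  imports "HOL-Analysis.Analysis"
begin

class complex_vector = real_vector +
  fixes scaleC :: "complex \<Rightarrow> 'a \<Rightarrow> 'a"
  assumes scaleC_add_right: "scaleC a (x + y) = scaleC a x + scaleC a y"
    and scaleC_add_left: "scaleC (a + b) x = scaleC a x + scaleC b x"
    and scaleC_scaleC: "scaleC a (scaleC b x) = scaleC (a * b) x"
    and scaleC_one: "scaleC 1 x = x"
    and scaleR_scaleC: "scaleR r x = scaleC (complex_of_real r) x"

class complex_normed_vector = complex_vector + real_normed_vector +
  assumes norm_scaleC: "norm (scaleC a x) = cmod a * norm x"

instantiation complex :: complex_normed_vector
begin
definition scaleC_complex_def: "scaleC a (x::complex) = a * x"
instance
  by standard (auto simp: scaleC_complex_def algebra_simps scaleR_conv_of_real norm_mult)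
end

definition cspan :: "'a::complex_vector set \<Rightarrow> 'a set" where
  "cspan S = {\<Sum>x\<in>F. scaleC (c x) x | F c. finite F \<and> F \<subseteq> S}"

definition fin_dim :: "'a::complex_vector set \<Rightarrow> bool" where
  "fin_dim V \<longleftrightarrow> (\<exists>F. finite F \<and> F \<subseteq> V \<and> cspan F = V)"

definition fin_codim_in :: "'a::complex_vector set \<Rightarrow> 'a set \<Rightarrow> bool" where
  "fin_codim_in M W \<longleftrightarrow>
     (\<exists>F. finite F \<and> F \<subseteq> M \<and> (\<forall>y\<in>M. \<exists>v\<in>W. \<exists>z\<in>cspan F. y = v + z))"

definition bcl :: "('a::complex_normed_vector \<Rightarrow> 'a) \<Rightarrow> bool" where
  "bcl T \<longleftrightarrow> bounded_linear T \<and> (\<forall>c x. T (scaleC c x) = scaleC c (T x))"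

definition nullsp :: "('a::complex_vector \<Rightarrow> 'a) \<Rightarrow> 'a set" where
  "nullsp S = {x. S x = 0}"

text \<open>Ascent is finite; and its value (meaningful only when finite).\<close>
definition finite_ascent :: "('a::complex_vector \<Rightarrow> 'a) \<Rightarrow> bool" where
  "finite_ascent S \<longleftrightarrow> (\<exists>n. nullsp (S ^^ n) = nullsp (S ^^ Suc n))"

definition ascent :: "('a::complex_vector \<Rightarrow> 'a) \<Rightarrow> nat" where
  "ascent S = (LEAST n. nullsp (S ^^ n) = nullsp (S ^^ Suc n))"

text \<open>Fredholm property of the restriction of S to the (invariant) subspace M,
  viewed as an operator on M.\<close>
definition fredholm_on :: "'a::complex_normed_vector set \<Rightarrow> ('a \<Rightarrow> 'a) \<Rightarrow> bool" where
  "fredholm_on M S \<longleftrightarrow> closedin (top_of_set M) (S ` M)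
     \<and> fin_dim {x\<in>M. S x = 0} \<and> fin_codim_in M (S ` M)"

definition fredholm :: "('a::complex_normed_vector \<Rightarrow> 'a) \<Rightarrow> bool" where
  "fredholm S \<longleftrightarrow> fredholm_on UNIV S"

definition upper_semi_fredholm :: "('a::complex_normed_vector \<Rightarrow> 'a) \<Rightarrow> bool" where
  "upper_semi_fredholm S \<longleftrightarrow> closed (range S) \<and> fin_dim (nullsp S)"

definition upper_semi_browder :: "('a::complex_normed_vector \<Rightarrow> 'a) \<Rightarrow> bool" where
  "upper_semi_browder S \<longleftrightarrow> upper_semi_fredholm S \<and> finite_ascent S"

definition b_fredholm :: "('a::complex_normed_vector \<Rightarrow> 'a) \<Rightarrow> bool" where
  "b_fredholm S \<longleftrightarrow> (\<exists>n. closed (range (S ^^ n)) \<and> fredholm_on (range (S ^^ n)) S)"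

definition left_drazin :: "('a::complex_normed_vector \<Rightarrow> 'a) \<Rightarrow> bool" where
  "left_drazin S \<longleftrightarrow> finite_ascent S \<and> closed (range (S ^^ Suc (ascent S)))"

definition shift :: "('a::complex_vector \<Rightarrow> 'a) \<Rightarrow> complex \<Rightarrow> 'a \<Rightarrow> 'a" where
  "shift T l = (\<lambda>x. T x - scaleC l x)"

definition ess_spec :: "('a::complex_normed_vector \<Rightarrow> 'a) \<Rightarrow> complex set" where
  "ess_spec T = {l. \<not> fredholm (shift T l)}"

definition ub_spec :: "('a::complex_normed_vector \<Rightarrow> 'a) \<Rightarrow> complex set" where
  "ub_spec T = {l. \<not> upper_semi_browder (shift T l)}"

definition bf_spec :: "('a::complex_normed_vector \<Rightarrow> 'a) \<Rightarrow> complex set" where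
  "bf_spec T = {l. \<not> b_fredholm (shift T l)}"

definition ld_spec :: "('a::complex_normed_vector \<Rightarrow> 'a) \<Rightarrow> complex set" where
  "ld_spec T = {l. \<not> left_drazin (shift T l)}"

end

theory Submission
  imports Defs
begin

text \<open>
  Write \<open>S = T - \<lambda>\<close>. Passing from the pair (B-Fredholm, left Drazin) to the pair (Fredholm, upper
  semi-Browder) is a pointwise matter: an upper semi-Browder operator is left Drazin invertible, a
  Fredholm operator is B-Fredholm, and an upper semi-Fredholm operator that is B-Fredholm is Fredholm.
  The converse passage uses nearby points \<open>\<lambda> + \<mu>\<close>, for which real \<open>\<mu> > 0\<close> suffice.

  If \<open>S\<close> is left Drazin invertible with ascent \<open>p\<close>, then \<open>S\<close> is bounded below on the closed subspace
  \<open>M = R(S ^^ p)\<close>, and \<open>S - \<mu>\<close> is bounded below on the whole space for small \<open>\<mu>\<close>; once it is Fredholm,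
  \<open>(S - \<mu>) M\<close> has finite codimension in \<open>M\<close>. The codimension of \<open>(S - t) M\<close> is locally constant in
  \<open>t \<in> [0, \<mu>]\<close>, so \<open>S M\<close> has finite codimension as well.

  If \<open>S\<close> is B-Fredholm, then \<open>S - \<mu>\<close> is Fredholm for small \<open>\<mu>\<close>. If moreover \<open>S\<close> had infinite ascent, it
  would map its closed hyperrange \<open>H\<close> onto itself with nonzero kernel; both properties survive for
  \<open>S - \<mu>\<close> on \<open>H\<close> and force \<open>S - \<mu>\<close> to have infinite ascent.
\<close>

section \<open>Open mapping and finite-dimensional subspaces\<close>

text \<open>Successive approximation: correcting the residual again and again makes it shrink like
  \<open>q ^ k\<close>, so the corrections form an absolutely convergent series whose sum stays in
  the closed subspace \<open>D\<close>. The same iteration serves the open mapping theorem and the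
  stability of surjectivity.\<close>

lemma approx_onto_imp_onto:
  fixes G :: "'b::banach \<Rightarrow> 'c::real_normed_vector"
  assumes G: "bounded_linear G" and D: "closed D" "subspace D"
    and q: "0 \<le> q" "q < 1"
    and approx: "\<And>y. y \<in> E \<Longrightarrow>
      \<exists>x\<in>D. norm x \<le> K * norm y \<and> y - G x \<in> E \<and> norm (y - G x) \<le> q * norm y"
    and y: "y \<in> E"
  shows "\<exists>x\<in>D. G x = y \<and> norm x \<le> K / (1 - q) * norm y"
proof -
  interpret G: bounded_linear G by fact
  have "\<forall>y\<in>E. \<exists>x. x \<in> D \<and> norm x \<le> K * norm y \<and> y - G x \<in> E \<and> norm (y - G x) \<le> q * norm y"
    using approx by blast
  then obtain h where h: "\<And>y. y \<in> E \<Longrightarrow> h y \<in> D \<and> norm (h y) \<le> K * norm y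
      \<and> y - G (h y) \<in> E \<and> norm (y - G (h y)) \<le> q * norm y"
    by metis
  define r where "r k = ((\<lambda>z. z - G (h z)) ^^ k) y" for k
  have r0: "r 0 = y" and rS: "r (Suc k) = r k - G (h (r k))" for k
    by (simp_all add: r_def)
  have rE: "r k \<in> E \<and> norm (r k) \<le> q ^ k * norm y" for k
  proof (induction k)
    case (Suc k)
    have "norm (r (Suc k)) \<le> q * norm (r k)" using h Suc by (simp add: rS)
    also have "\<dots> \<le> q * (q ^ k * norm y)" using Suc q by (intro mult_left_mono) auto
    finally show ?case using h Suc by (simp add: rS mult.assoc)
  qed (simp add: r0 y)
  \<comment> \<open>\<open>K\<close> has no sign a priori: a nonzero residual forces
    \<open>0 \<le> K\<close>, and a zero residual has a zero correction.\<close>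
  have bound: "norm (h (r k)) \<le> K * norm y * q ^ k" for k
  proof (cases "norm (r k) = 0")
    case True
    then have "norm (h (r k)) \<le> 0" using h rE by (metis mult_zero_right)
    moreover have "0 \<le> K * norm y * q ^ k"
    proof (cases "y = 0")
      case False
      then have "0 \<le> K * norm y" using h[OF y] norm_ge_zero order_trans by blast
      then show ?thesis using q by simp
    qed auto
    ultimately show ?thesis by linarith
  next
    case False
    have "0 \<le> K * norm (r k)" using h rE norm_ge_zero order_trans by blast
    then have "0 \<le> K" using False by (simp add: zero_le_mult_iff)
    have "norm (h (r k)) \<le> K * norm (r k)" using h rE by blast
    also have "\<dots> \<le> K * (q ^ k * norm y)" using rE \<open>0 \<le> K\<close> by (intro mult_left_mono) auto
    finally show ?thesis by (simp add: mult_ac)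
  qed
  have geo: "(\<lambda>k. K * norm y * q ^ k) sums (K * norm y * (1 / (1 - q)))"
    using q by (intro sums_mult geometric_sums) auto
  have sn: "summable (\<lambda>k. norm (h (r k)))"
    by (rule summable_comparison_test[OF _ sums_summable[OF geo]]) (use bound in auto)
  then have sx: "summable (\<lambda>k. h (r k))" by (rule summable_norm_cancel)
  define x where "x = (\<Sum>k. h (r k))"
  have "x \<in> D"
  proof (rule closed_sequentially[OF D(1)])
    show "(\<lambda>n. \<Sum>k<n. h (r k)) \<longlonglongrightarrow> x" using sx unfolding x_def by (rule summable_LIMSEQ)
    show "(\<Sum>k<n. h (r k)) \<in> D" for n using D h rE by (intro subspace_sum) auto
  qed
  moreover have "norm x \<le> K / (1 - q) * norm y"
  proof -
    have "norm x \<le> (\<Sum>k. norm (h (r k)))" unfolding x_def using sn by (rule summable_norm)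
    also have "\<dots> \<le> (\<Sum>k. K * norm y * q ^ k)"
      using bound sn sums_summable[OF geo] by (intro suminf_le) auto
    also have "\<dots> = K / (1 - q) * norm y" using sums_unique[OF geo] by simp
    finally show ?thesis .
  qed
  moreover have "G x = y"
  proof -
    have "(\<lambda>k. norm y * q ^ k) \<longlonglongrightarrow> 0"
      using q by (intro tendsto_mult_right_zero LIMSEQ_power_zero) auto
    then have "r \<longlonglongrightarrow> 0"
      by (rule Lim_null_comparison[rotated]) (use rE in \<open>auto simp: mult.commute\<close>)
    then have "(\<lambda>k. r k - r (Suc k)) sums (r 0 - 0)" by (rule telescope_sums')
    then have "(\<lambda>k. G (h (r k))) sums y" by (simp add: rS r0)
    moreover have "(\<lambda>k. G (h (r k))) sums G x"
      unfolding x_def using summable_sums[OF sx] by (rule G.sums)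
    ultimately show ?thesis using sums_unique2 by blast
  qed
  ultimately show ?thesis by blast
qed

lemma open_mapping_closed_image:
  fixes G :: "'b::banach \<Rightarrow> 'c::banach"
  assumes G: "bounded_linear G" and D: "closed D" "subspace D" and E: "closed (G ` D)"
  shows "\<exists>K>0. \<forall>y\<in>G ` D. \<exists>x\<in>D. G x = y \<and> norm x \<le> K * norm y"
proof -
  interpret G: bounded_linear G by fact
  define E where "E = G ` D"
  define C where "C n = closure (G ` (D \<inter> cball 0 (real n)))" for n
  have subE: "subspace E" unfolding E_def using D G.linear_axioms by (simp add: linear_subspace_image)
  have CE: "C n \<subseteq> E" for n unfolding C_def E_def using E by (intro closure_minimal) auto
  have cover: "E = (\<Union>n. C n)"
  proof
    show "E \<subseteq> (\<Union>n. C n)"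
    proof
      fix y assume "y \<in> E"
      then obtain x where x: "x \<in> D" "y = G x" unfolding E_def by blast
      obtain n where "norm x \<le> real n" using real_arch_simple by blast
      then have "y \<in> C n" unfolding C_def using x by (intro subsetD[OF closure_subset]) auto
      then show "y \<in> (\<Union>n. C n)" by blast
    qed
  qed (use CE in blast)
  have "\<exists>n. top_of_set E interior_of C n \<noteq> {}"
  proof (rule ccontr)
    assume neg: "\<nexists>n. top_of_set E interior_of C n \<noteq> {}"
    have "completely_metrizable_space (top_of_set E)"
      using E unfolding E_def
      by (simp add: completely_metrizable_space_closedin completely_metrizable_space_euclidean)
    then have "top_of_set E interior_of \<Union>(range C) = {}"
      using neg CE by (intro Baire_category_alt) (auto simp: closedin_subset C_def closed_subset)
    then have "top_of_set E interior_of E = {}" using cover by simp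
    then have "E = {}" using interior_of_topspace[of "top_of_set E"] by simp
    then show False using subE subspace_0 by blast
  qed
  then obtain n y0 where "y0 \<in> top_of_set E interior_of C n" by blast
  then obtain U where U: "openin (top_of_set E) U" "y0 \<in> U" "U \<subseteq> C n"
    unfolding interior_of_def by blast
  then have "U \<subseteq> E" "\<exists>r>0. ball y0 r \<inter> E \<subseteq> U" by (simp_all add: openin_contains_ball)
  then obtain r where r: "r > 0" "ball y0 r \<inter> E \<subseteq> U" and y0: "y0 \<in> E"
    using U by blast
  \<comment> \<open>Both \<open>y0 + y\<close> and \<open>y0\<close> are approximated by images of
    vectors of norm at most \<open>n\<close>; the difference of the two vectors handles
    \<open>y\<close> at the price of doubling the bound.\<close>
  have small: "\<exists>x\<in>D. norm x \<le> 2 * real n \<and> norm (y - G x) < e"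
    if y: "y \<in> E" "norm y < r" and e: "e > 0" for y e
  proof -
    have "y0 + y \<in> C n" "y0 \<in> C n"
      using r U y y0 subE by (auto simp: subspace_add dist_norm intro!: subsetD[OF U(3)] subsetD[OF r(2)])
    then obtain a b where "a \<in> G ` (D \<inter> cball 0 (real n))" "dist a (y0 + y) < e/2"
      "b \<in> G ` (D \<inter> cball 0 (real n))" "dist b y0 < e/2"
      unfolding C_def closure_approachable using e half_gt_zero by metis
    then obtain u v where uv: "u \<in> D" "norm u \<le> real n" "dist (G u) (y0 + y) < e/2"
      "v \<in> D" "norm v \<le> real n" "dist (G v) y0 < e/2" by auto
    have "norm (y - G (u - v)) = norm ((G v - y0) - (G u - (y0 + y)))"
      by (simp add: G.diff algebra_simps)
    also have "\<dots> < e" using uv norm_triangle_ineq4[of "G v - y0" "G u - (y0 + y)"]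
      by (simp add: dist_norm)
    finally have "norm (y - G (u - v)) < e" .
    moreover have "norm (u - v) \<le> 2 * real n" using uv norm_triangle_ineq4[of u v] by simp
    ultimately show ?thesis using uv D by (auto intro!: bexI[of _ "u - v"] simp: subspace_diff)
  qed
  \<comment> \<open>A vector \<open>y\<close> is scaled to norm \<open>r / 2\<close>, solved there
    with a vector of norm at most \<open>2 n\<close>, and scaled back by
    \<open>2 norm y / r\<close>.\<close>
  define K where "K = 4 * real n / r"
  have approx: "\<exists>x\<in>D. norm x \<le> K * norm y \<and> y - G x \<in> E \<and> norm (y - G x) \<le> 1/2 * norm y"
    if y: "y \<in> E" for y
  proof (cases "y = 0")
    case True
    then show ?thesis using D subE by (auto intro!: bexI[of _ 0] simp: subspace_0)
  next
    case False
    define s where "s = r / (2 * norm y)"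
    have s: "s > 0" using r False by (simp add: s_def)
    have "s *\<^sub>R y \<in> E" using y subE by (simp add: subspace_scale)
    moreover have "norm (s *\<^sub>R y) < r" using s r False by (simp add: s_def)
    ultimately obtain x where x: "x \<in> D" "norm x \<le> 2 * real n" "norm (s *\<^sub>R y - G x) < s * norm y / 2"
      using small[of "s *\<^sub>R y" "s * norm y / 2"] s False by auto
    let ?x = "inverse s *\<^sub>R x"
    have "y - G ?x = inverse s *\<^sub>R (s *\<^sub>R y - G x)" using s by (simp add: G.scaleR algebra_simps)
    then have "norm (y - G ?x) = inverse s * norm (s *\<^sub>R y - G x)" using s by simp
    also have "\<dots> \<le> inverse s * (s * norm y / 2)" using x s by (intro mult_left_mono) auto
    also have "\<dots> = 1/2 * norm y" using s by (simp add: field_simps)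
    finally have "norm (y - G ?x) \<le> 1/2 * norm y" .
    moreover have "norm ?x \<le> K * norm y"
    proof -
      have "norm ?x \<le> inverse s * (2 * real n)" using x s by simp
      also have "\<dots> = K * norm y" using r False by (simp add: s_def K_def field_simps)
      finally show ?thesis .
    qed
    moreover have "y - G ?x \<in> E" using y x D subE
      by (intro subspace_diff) (auto simp: E_def subspace_scale)
    ultimately show ?thesis using x D by (auto intro!: bexI[of _ ?x] simp: subspace_scale)
  qed
  have "K \<ge> 0" using r by (simp add: K_def)
  show ?thesis
  \<comment> \<open>The iteration with \<open>q = 1/2\<close> gives \<open>2 * K\<close>; the added
    1 keeps the constant positive when \<open>n = 0\<close>.\<close>
  proof (intro exI[of _ "2 * K + 1"] conjI ballI)
    show "2 * K + 1 > 0" using \<open>K \<ge> 0\<close> by simp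
    fix y assume "y \<in> G ` D"
    then have "y \<in> E" by (simp add: E_def)
    then obtain x where "x \<in> D" "G x = y" "norm x \<le> K / (1 - 1/2) * norm y"
      using approx_onto_imp_onto[OF G D _ _ approx] by force
    then show "\<exists>x\<in>D. G x = y \<and> norm x \<le> (2 * K + 1) * norm y"
      by (auto intro!: bexI[of _ x] simp: algebra_simps intro: order_trans)
  qed
qed

section \<open>Closedness, compactness and the Riesz lemma for finite-dimensional subspaces\<close>

lemma far_from_closed_subspace:
  assumes V: "closed V" "subspace V" and a: "a \<notin> V"
  obtains d where "d > 0" "\<And>v c. v \<in> V \<Longrightarrow> \<bar>c\<bar> * d \<le> norm (v + c *\<^sub>R a)"
proof -
  have "open (- V)" using V by auto
  then obtain d where d: "d > 0" "ball a d \<subseteq> - V" using a openE by blast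
  have "\<bar>c\<bar> * d \<le> norm (v + c *\<^sub>R a)" if v: "v \<in> V" for v c
  proof (cases "c = 0")
    case False
    let ?w = "(- inverse c) *\<^sub>R v"
    have "?w \<in> V" using v V by (intro subspace_scale)
    then have "d \<le> dist a ?w" using d by (meson ComplD mem_ball not_less subsetD)
    then have "\<bar>c\<bar> * d \<le> \<bar>c\<bar> * norm (a - ?w)" by (simp add: dist_norm mult_left_mono)
    also have "\<dots> = norm (c *\<^sub>R (a - ?w))" by simp
    also have "c *\<^sub>R (a - ?w) = v + c *\<^sub>R a" using False by (simp add: algebra_simps)
    finally show ?thesis .
  qed auto
  with d show ?thesis using that by blast
qed

text \<open>By \<open>far_from_closed_subspace\<close> the coefficient of \<open>a\<close> is
  controlled by the norm of the vector. Along a convergent sequence the coefficients are therefore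
  Cauchy, and so the components in \<open>V\<close> converge as well.\<close>

lemma closed_span_insert:
  fixes V :: "'a::banach set"
  assumes V: "closed V" "subspace V"
  shows "closed (span (insert a V))"
proof (cases "a \<in> V")
  case True
  then show ?thesis using V by (simp add: insert_absorb span_eq_iff[THEN iffD2])
next
  case False
  then obtain d where d: "d > 0" "\<And>v c. v \<in> V \<Longrightarrow> \<bar>c\<bar> * d \<le> norm (v + c *\<^sub>R a)"
    using far_from_closed_subspace[OF V] by blast
  have sV: "span V = V" using V by (simp add: span_eq_iff[THEN iffD2])
  show ?thesis unfolding closed_sequential_limits
  proof (intro allI impI, elim conjE)
    fix y l assume y: "\<forall>n. y n \<in> span (insert a V)" and l: "y \<longlonglongrightarrow> l"
    then have "\<forall>n. \<exists>k. y n - k *\<^sub>R a \<in> V" by (simp add: span_insert sV)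
    then obtain c where c: "\<And>n. y n - c n *\<^sub>R a \<in> V" by metis
    have "Cauchy c"
    proof (rule metric_CauchyI)
      fix e :: real assume "e > 0"
      then obtain M where M: "\<And>m n. m \<ge> M \<Longrightarrow> n \<ge> M \<Longrightarrow> dist (y m) (y n) < e * d"
        using metric_CauchyD[OF LIMSEQ_imp_Cauchy[OF l], of "e * d"] d by (metis mult_pos_pos)
      have "dist (c m) (c n) < e" if "m \<ge> M" "n \<ge> M" for m n
      proof -
        have "(y m - c m *\<^sub>R a) - (y n - c n *\<^sub>R a) \<in> V" using c V by (simp add: subspace_diff)
        from d(2)[OF this, of "c m - c n"] have "\<bar>c m - c n\<bar> * d \<le> norm (y m - y n)"
          by (simp add: algebra_simps)
        also have "\<dots> < e * d" using M that by (simp add: dist_norm)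
        finally show ?thesis using d by (simp add: dist_norm)
      qed
      then show "\<exists>M. \<forall>m\<ge>M. \<forall>n\<ge>M. dist (c m) (c n) < e" by blast
    qed
    then obtain k where "c \<longlonglongrightarrow> k" using convergent_eq_Cauchy by blast
    then have "(\<lambda>n. y n - c n *\<^sub>R a) \<longlonglongrightarrow> l - k *\<^sub>R a" by (intro tendsto_intros l)
    then have "l - k *\<^sub>R a \<in> V" by (rule closed_sequentially[OF V(1), rotated]) (rule c)
    then show "l \<in> span (insert a V)" by (auto simp: span_insert sV)
  qed
qed

lemma closed_span_Un_finite:
  fixes V :: "'a::banach set"
  assumes V: "closed V" "subspace V" and "finite F"
  shows "closed (span (V \<union> F))"
  using \<open>finite F\<close>
proof induction
  case empty
  then show ?case using V by (simp add: span_eq_iff[THEN iffD2])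
next
  case (insert a F)
  have "span (insert a (span (V \<union> F))) = span (V \<union> insert a F)"
    by (simp add: span_insert span_span)
  then show ?case using closed_span_insert[OF insert.IH, of a] by simp
qed

lemma closed_span_finite:
  fixes F :: "'a::banach set"
  assumes "finite F"
  shows "closed (span F)"
  using closed_span_Un_finite[of "{0}" F] assms by simp

text \<open>Induction on the generators: a vector in the ball has a bounded coefficient of
  \<open>a\<close>, hence a bounded remainder in \<open>span F\<close>. So the set is a closed part
  of the continuous image of a compact product. The remainder may have norm above \<open>R\<close>,
  which is why the radius varies in the induction.\<close>

lemma compact_span_Int_cball:
  fixes F :: "'a::banach set"
  assumes "finite F"
  shows "compact (span F \<inter> cball 0 R)"
  using assms
proof (induction arbitrary: R)
  case empty
  have "finite ({0} \<inter> cball (0::'a) R)" by simp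
  then show ?case by (simp only: span_empty finite_imp_compact)
next
  case (insert a F)
  show ?case
  proof (cases "a \<in> span F")
    case True
    then show ?thesis using insert.IH by (simp add: span_redundant)
  next
    case False
    obtain d where d: "d > 0" "\<And>v c. v \<in> span F \<Longrightarrow> \<bar>c\<bar> * d \<le> norm (v + c *\<^sub>R a)"
      using far_from_closed_subspace[OF closed_span_finite[OF insert.hyps(1)] subspace_span False] by blast
    let ?C = "(span F \<inter> cball 0 (R + R / d * norm a)) \<times> {- (R / d)..R / d}"
    let ?f = "\<lambda>(v, c). v + c *\<^sub>R a"
    have "compact ?C" by (intro compact_Times insert.IH compact_Icc)
    moreover have "continuous_on ?C ?f" by (auto simp: case_prod_beta intro!: continuous_intros)
    ultimately have "compact (?f ` ?C)" by (rule compact_continuous_image[rotated])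
    moreover have "span (insert a F) \<inter> cball 0 R \<subseteq> ?f ` ?C"
    proof
      fix x assume x: "x \<in> span (insert a F) \<inter> cball 0 R"
      then obtain c where c: "x - c *\<^sub>R a \<in> span F" by (auto simp: span_insert)
      have "\<bar>c\<bar> * d \<le> norm x" using d(2)[OF c, of c] by simp
      then have "\<bar>c\<bar> * d \<le> R" using x by simp
      then have cR: "\<bar>c\<bar> \<le> R / d" using d by (simp add: field_simps)
      have "norm (x - c *\<^sub>R a) \<le> norm x + \<bar>c\<bar> * norm a" using norm_triangle_ineq4[of x "c *\<^sub>R a"] by simp
      also have "\<dots> \<le> R + R / d * norm a" using x cR by (intro add_mono mult_right_mono) auto
      finally have "norm (x - c *\<^sub>R a) \<le> R + R / d * norm a" .
      then show "x \<in> ?f ` ?C" using c cR by (intro image_eqI[of _ _ "(x - c *\<^sub>R a, c)"]) auto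
    qed
    moreover have "closed (span (insert a F) \<inter> cball 0 R)"
      using insert.hyps by (intro closed_Int closed_span_finite closed_cball) auto
    ultimately show ?thesis by (metis compact_Int_closed inf.absorb_iff2)
  qed
qed

lemma riesz_lemma_span_finite:
  fixes F :: "'a::banach set"
  assumes U: "subspace U" and F: "finite F" "F \<subseteq> U" and ne: "U \<noteq> span F"
  obtains x where "x \<in> U" "norm x = 1" "\<And>v. v \<in> span F \<Longrightarrow> 1/2 \<le> norm (x - v)"
proof -
  have "span F \<subseteq> U" using U F by (simp add: span_minimal)
  then obtain a where a: "a \<in> U" "a \<notin> span F" using ne by blast
  let ?d = "infdist a (span F)"
  have ne: "span F \<noteq> {}" using span_zero by blast
  have "?d \<noteq> 0" using a closed_span_finite[OF F(1)] ne in_closed_iff_infdist_zero by blast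
  then have d: "?d > 0" using infdist_nonneg[of a "span F"] by linarith
  then have "?d < 2 * ?d" by linarith
  \<comment> \<open>A point of \<open>span F\<close> within twice the distance of \<open>a\<close>;
    normalizing \<open>a - v\<close> then gives the separation 1/2.\<close>
  then obtain v where v: "v \<in> span F" "dist a v < 2 * ?d"
    by (metis infdist_notempty[OF ne] cINF_less_iff ne bdd_below.I2 zero_le_dist)
  let ?n = "norm (a - v)"
  have n: "?n \<noteq> 0" using a v by auto
  show ?thesis
  proof
    show "inverse ?n *\<^sub>R (a - v) \<in> U"
      using a v U \<open>span F \<subseteq> U\<close> by (intro subspace_scale subspace_diff) auto
    show "norm (inverse ?n *\<^sub>R (a - v)) = 1" using n by simp
    fix w assume w: "w \<in> span F"
    have "v + ?n *\<^sub>R w \<in> span F" using v w by (simp add: span_add span_scale)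
    then have "?d \<le> norm (a - (v + ?n *\<^sub>R w))" by (metis dist_norm infdist_le)
    also have "a - (v + ?n *\<^sub>R w) = ?n *\<^sub>R (inverse ?n *\<^sub>R (a - v) - w)"
      using n by (simp add: algebra_simps)
    finally have "?d \<le> ?n * norm (inverse ?n *\<^sub>R (a - v) - w)" by simp
    moreover have "?n / 2 < ?d" using v by (simp add: dist_norm)
    ultimately have "?n * (1/2) \<le> ?n * norm (inverse ?n *\<^sub>R (a - v) - w)" by linarith
    moreover have "?n > 0" using n by simp
    ultimately show "1/2 \<le> norm (inverse ?n *\<^sub>R (a - v) - w)" using mult_le_cancel_left_pos by blast
  qed
qed

text \<open>Otherwise the Riesz lemma produces arbitrarily many unit vectors of \<open>U\<close> at
  mutual distance at least 1/2. Each is within 1/8 of a point in a compact ball of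
  \<open>span F\<close>, which is covered by finitely many balls of radius 1/8. By the pigeonhole
  principle two of the vectors lie within 1/4 of the same centre, hence at distance below
  1/2.\<close>

lemma near_finite_dim_imp_finite_dim:
  fixes F :: "'a::banach set"
  assumes U: "subspace U" and F: "finite F"
    and near: "\<And>x. x \<in> U \<Longrightarrow> \<exists>y\<in>span F. norm (x - y) \<le> 1/8 * norm x"
  shows "\<exists>B. finite B \<and> U = span B"
proof (rule ccontr)
  assume inf: "\<nexists>B. finite B \<and> U = span B"
  define P where "P N B \<longleftrightarrow> finite B \<and> card B = N \<and> B \<subseteq> U \<and> (\<forall>x\<in>B. norm x = 1)
      \<and> (\<forall>x\<in>B. \<forall>y\<in>B. x \<noteq> y \<longrightarrow> 1/2 \<le> norm (x - y))" for N :: nat and B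
  have sep: "\<exists>B. P N B" for N
  proof (induction N)
    case 0
    then show ?case by (intro exI[of _ "{}"]) (auto simp: P_def)
  next
    case (Suc N)
    then obtain B where "P N B" by blast
    then have B: "finite B" "card B = N" "B \<subseteq> U" "\<forall>x\<in>B. norm x = 1"
      "\<forall>x\<in>B. \<forall>y\<in>B. x \<noteq> y \<longrightarrow> 1/2 \<le> norm (x - y)" by (simp_all add: P_def)
    have "U \<noteq> span B" using inf B by blast
    then obtain x where x: "x \<in> U" "norm x = 1" "\<And>v. v \<in> span B \<Longrightarrow> 1/2 \<le> norm (x - v)"
      using riesz_lemma_span_finite[OF U B(1,3)] by blast
    have "x \<notin> B" using x(3)[OF span_base, of x] by auto
    moreover have "1/2 \<le> norm (x - y)" "1/2 \<le> norm (y - x)" if "y \<in> B" for y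
      using x(3)[OF span_base[OF that]] by (simp_all add: norm_minus_commute)
    ultimately show ?case using B x by (intro exI[of _ "insert x B"]) (auto simp: P_def)
  qed
  have "compact (span F \<inter> cball 0 2)" using F by (rule compact_span_Int_cball)
  then have "\<forall>e>0. \<exists>k. finite k \<and> span F \<inter> cball 0 2 \<subseteq> (\<Union>x\<in>k. ball x e)"
    by (simp add: compact_eq_totally_bounded)
  then have "\<exists>k. finite k \<and> span F \<inter> cball 0 2 \<subseteq> (\<Union>x\<in>k. ball x (1/8))"
    by (rule allE[of _ "1/8"]) simp
  then obtain k where k: "finite k" "span F \<inter> cball 0 2 \<subseteq> (\<Union>x\<in>k. ball x (1/8))"
    by (elim exE conjE)
  obtain B where "P (Suc (card k)) B" using sep by blast
  then have B: "finite B" "card B = Suc (card k)" "B \<subseteq> U" "\<forall>x\<in>B. norm x = 1"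
      "\<forall>x\<in>B. \<forall>y\<in>B. x \<noteq> y \<longrightarrow> 1/2 \<le> norm (x - y)" by (simp_all add: P_def)
  have "\<exists>z\<in>k. norm (x - z) < 1/4" if "x \<in> B" for x
  proof -
    have "x \<in> U" "norm x = 1" using that B by auto
    then obtain y where y: "y \<in> span F" "norm (x - y) \<le> 1/8" using near[of x] by auto
    have "norm y \<le> norm x + norm (x - y)" by (metis norm_minus_commute norm_triangle_sub)
    then have "y \<in> span F \<inter> cball 0 2" using y B that by auto
    then obtain z where "z \<in> k" "norm (z - y) < 1/8" using k by (auto simp: dist_norm)
    then show ?thesis using y norm_triangle_ineq4[of "x - y" "z - y"] by (intro bexI[of _ z]) auto
  qed
  then obtain g where g: "\<And>x. x \<in> B \<Longrightarrow> g x \<in> k \<and> norm (x - g x) < 1/4" by metis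
  have "\<not> inj_on g B"
  proof
    assume "inj_on g B"
    then have "card B \<le> card k" using g k by (intro card_inj_on_le) auto
    then show False using B by simp
  qed
  then obtain x y where xy: "x \<in> B" "y \<in> B" "x \<noteq> y" "g x = g y" by (auto simp: inj_on_def)
  then have "norm (x - y) < 1/2"
    using g[of x] g[of y] norm_triangle_ineq4[of "x - g x" "y - g x"] by simp
  then show False using B xy by force
qed

section \<open>Stability of finite codimension\<close>

lemma bounded_linear_fst_plus_snd:
  fixes G :: "'b::real_normed_vector \<Rightarrow> 'a::real_normed_vector"
  assumes "bounded_linear G"
  shows "bounded_linear (\<lambda>p. G (fst p) + snd p)"
  by (intro bounded_linear_add bounded_linear_compose[OF assms] bounded_linear_fst bounded_linear_snd)

text \<open>The open mapping theorem for \<open>(x, v) \<mapsto> G x + v\<close> bounds the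
  \<open>N\<close>-component of a vector by its norm. If \<open>y = G u + f\<close> is a limit of
  vectors \<open>G x\<close>, then every \<open>y - G x\<close> has the same component
  \<open>f\<close>, since the sum is direct; as these differences become small,
  \<open>f = 0\<close>.\<close>

lemma closed_range_if_direct_sum_closed:
  fixes G :: "'b::banach \<Rightarrow> 'a::banach"
  assumes G: "bounded_linear G" and N: "closed N" "subspace N"
    and E: "closed {G x + v | x v. v \<in> N}" and direct: "\<And>x. G x \<in> N \<Longrightarrow> G x = 0"
  shows "closed (range G)"
proof -
  interpret G: bounded_linear G by fact
  let ?H = "\<lambda>p. G (fst p) + snd p" and ?D = "UNIV \<times> N"
  have D: "closed ?D" "subspace ?D" using N by (auto simp: closed_Times subspace_Times)
  have img: "?H ` ?D = {G x + v | x v. v \<in> N}" by force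
  have cl: "closed (?H ` ?D)" using E by (simp only: img)
  obtain K where K: "K > 0" "\<And>y. y \<in> ?H ` ?D \<Longrightarrow> \<exists>p\<in>?D. ?H p = y \<and> norm p \<le> K * norm y"
    using open_mapping_closed_image[OF bounded_linear_fst_plus_snd[OF G] D cl] by blast
  have "closure (range G) \<subseteq> range G"
  proof
    fix y assume y: "y \<in> closure (range G)"
    have "0 \<in> N" using N by (simp add: subspace_0)
    then have "range G \<subseteq> {G x + v | x v. v \<in> N}" by force
    then have "y \<in> {G x + v | x v. v \<in> N}" using y closure_minimal[OF _ E] by blast
    then obtain u f where uf: "y = G u + f" "f \<in> N" by blast
    have "norm f \<le> e" if "e > 0" for e
    proof -
      obtain x where x: "norm (G x - y) < e / K"
        using y K \<open>e > 0\<close> unfolding closure_approachable dist_norm by (metis divide_pos_pos rangeE)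
      have z: "y - G x = G (u - x) + f" using uf by (simp add: G.diff)
      then have "y - G x \<in> ?H ` ?D" unfolding img using uf by blast
      then obtain x' f' where p: "f' \<in> N" "G x' + f' = y - G x" "norm (x', f') \<le> K * norm (y - G x)"
        using K(2) by force
      then have "G (x' - (u - x)) = f - f'" using z by (simp add: G.diff G.add algebra_simps)
      then have "f = f'" using direct[of "x' - (u - x)"] uf p N by (metis eq_iff_diff_eq_0 subspace_diff)
      then have "norm f \<le> K * norm (y - G x)" using p norm_snd_le[of f' x'] by (metis order_trans)
      also have "\<dots> \<le> K * (e / K)" using x K by (intro mult_left_mono) (auto simp: norm_minus_commute)
      finally show ?thesis using K by simp
    qed
    then have "norm f \<le> 0" using field_le_epsilon[of "norm f" 0] by simp
    then show "y \<in> range G" using uf by simp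
  qed
  then show ?thesis by (simp add: closure_subset_eq)
qed

text \<open>The map \<open>(x, f) \<mapsto> A x + f\<close> sends \<open>M \<times> span F\<close>
  onto \<open>M\<close> with preimages bounded by \<open>K\<close>. Using such a preimage for
  \<open>B\<close> leaves the error \<open>A x - B x\<close>, at most half of the norm of
  \<open>y\<close> for \<open>e = 1 / (2 * K)\<close>, and iteration removes it. The norm bound in
  the conclusion also controls the size of solutions for the perturbed operator.\<close>

lemma complement_stable:
  fixes A :: "'a::banach \<Rightarrow> 'a"
  assumes A: "bounded_linear A" and M: "closed M" "subspace M" "A ` M \<subseteq> M"
    and F: "finite F" "F \<subseteq> M" and onto: "\<And>y. y \<in> M \<Longrightarrow> \<exists>x\<in>M. \<exists>f\<in>span F. y = A x + f"
  shows "\<exists>e>0. \<exists>K>0. \<forall>B. bounded_linear B \<longrightarrow> B ` M \<subseteq> M \<longrightarrow> (\<forall>x\<in>M. norm (B x - A x) \<le> e * norm x)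
      \<longrightarrow> (\<forall>y\<in>M. \<exists>x\<in>M. \<exists>f\<in>span F. y = B x + f \<and> norm x \<le> K * norm y)"
proof -
  let ?D = "M \<times> span F"
  have D: "closed ?D" "subspace ?D" using M F by (auto simp: closed_Times subspace_Times closed_span_finite)
  have spF: "span F \<subseteq> M" using F M by (simp add: span_minimal)
  have img: "(\<lambda>p. A (fst p) + snd p) ` ?D = M"
  proof
    show "(\<lambda>p. A (fst p) + snd p) ` ?D \<subseteq> M" using M spF by (auto intro!: subspace_add)
    show "M \<subseteq> (\<lambda>p. A (fst p) + snd p) ` ?D" using onto by force
  qed
  have cl: "closed ((\<lambda>p. A (fst p) + snd p) ` ?D)" using M by (simp only: img)
  obtain K where K: "K > 0" "\<And>y. y \<in> M \<Longrightarrow> \<exists>p\<in>?D. A (fst p) + snd p = y \<and> norm p \<le> K * norm y"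
    using open_mapping_closed_image[OF bounded_linear_fst_plus_snd[OF A] D cl] unfolding img by blast
  show ?thesis
  proof (rule exI[of _ "1 / (2 * K)"], intro exI[of _ "2 * K"] conjI allI impI ballI)
    show "1 / (2 * K) > 0" "2 * K > 0" using K by auto
    fix B y assume B: "bounded_linear B" "B ` M \<subseteq> M" and y: "y \<in> M"
      and close: "\<forall>x\<in>M. norm (B x - A x) \<le> 1 / (2 * K) * norm x"
    have approx: "\<exists>p\<in>?D. norm p \<le> K * norm y \<and> y - (B (fst p) + snd p) \<in> M
        \<and> norm (y - (B (fst p) + snd p)) \<le> 1/2 * norm y" if "y \<in> M" for y
    proof -
      obtain x f where p: "x \<in> M" "f \<in> span F" "A x + f = y" "norm (x, f) \<le> K * norm y"
        using K(2)[OF \<open>y \<in> M\<close>] by force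
      have eq: "y - (B x + f) = A x - B x" using p by (simp add: algebra_simps)
      have "norm (A x - B x) \<le> 1 / (2 * K) * norm x" using close p(1) by (metis norm_minus_commute)
      also have "\<dots> \<le> 1 / (2 * K) * (K * norm y)"
        using p norm_fst_le[of x f] K by (intro mult_left_mono) auto
      also have "\<dots> = 1/2 * norm y" using K by simp
      finally have "norm (A x - B x) \<le> 1/2 * norm y" .
      moreover have "A x - B x \<in> M" using p B M by (auto intro!: subspace_diff)
      ultimately show ?thesis using p eq by (intro bexI[of _ "(x, f)"]) auto
    qed
    obtain p where "p \<in> ?D" "B (fst p) + snd p = y" "norm p \<le> K / (1 - 1/2) * norm y"
      using approx_onto_imp_onto[OF bounded_linear_fst_plus_snd[OF B(1)] D _ _ approx y] by force
    then show "\<exists>x\<in>M. \<exists>f\<in>span F. y = B x + f \<and> norm x \<le> 2 * K * norm y"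
      using norm_fst_le[of "fst p" "snd p"] by (intro bexI[of _ "fst p"] bexI[of _ "snd p"]) auto
  qed
qed

lemma injective_mod_stable:
  fixes A :: "'a::banach \<Rightarrow> 'a"
  assumes A: "bounded_linear A" and M: "closed M" "subspace M" "closed (A ` M)" and F: "finite F"
    and inj: "\<And>x. x \<in> M \<Longrightarrow> A x \<in> span F \<Longrightarrow> x = 0"
  shows "\<exists>e>0. \<forall>B. (\<forall>x\<in>M. norm (B x - A x) \<le> e * norm x) \<longrightarrow> (\<forall>x\<in>M. B x \<in> span F \<longrightarrow> x = 0)"
proof -
  interpret A: bounded_linear A by fact
  let ?D = "M \<times> span F"
  have D: "closed ?D" "subspace ?D" using M F by (auto simp: closed_Times subspace_Times closed_span_finite)
  have subAM: "subspace (A ` M)" using M A.linear_axioms by (simp add: linear_subspace_image)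
  have "(\<lambda>p. A (fst p) + snd p) ` ?D = {x + y | x y. x \<in> A ` M \<and> y \<in> span F}" by force
  also have "\<dots> = span (A ` M \<union> F)" by (simp only: span_Un span_eq_iff[THEN iffD2, OF subAM])
  finally have img: "(\<lambda>p. A (fst p) + snd p) ` ?D = span (A ` M \<union> F)" .
  have "closed (span (A ` M \<union> F))" using M(3) subAM F by (rule closed_span_Un_finite)
  then have cl: "closed ((\<lambda>p. A (fst p) + snd p) ` ?D)" by (simp only: img)
  obtain K where K: "K > 0"
    "\<And>y. y \<in> (\<lambda>p. A (fst p) + snd p) ` ?D \<Longrightarrow> \<exists>p\<in>?D. A (fst p) + snd p = y \<and> norm p \<le> K * norm y"
    using open_mapping_closed_image[OF bounded_linear_fst_plus_snd[OF A] D cl] by blast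
  have bound: "norm x \<le> K * norm (A x + f)" if "x \<in> M" "f \<in> span F" for x f
  proof -
    have "A x + f \<in> (\<lambda>p. A (fst p) + snd p) ` ?D" using that by (intro image_eqI[of _ _ "(x, f)"]) auto
    then obtain x' f' where p: "x' \<in> M" "f' \<in> span F" "A x' + f' = A x + f" "norm (x', f') \<le> K * norm (A x + f)"
      using K(2) by force
    then have "A (x - x') = f' - f" by (simp add: A.diff algebra_simps)
    then have "x = x'" using inj[of "x - x'"] p that M by (simp add: span_diff subspace_diff)
    then show ?thesis using p norm_fst_le[of x' f'] by (metis order_trans)
  qed
  show ?thesis
  proof (intro exI[of _ "1 / (2 * K)"] conjI allI impI ballI)
    show "1 / (2 * K) > 0" using K by simp
    fix B x assume close: "\<forall>x\<in>M. norm (B x - A x) \<le> 1 / (2 * K) * norm x"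
      and x: "x \<in> M" "B x \<in> span F"
    \<comment> \<open>The bound is used with \<open>f = - B x\<close>, which turns it into an
      estimate by the perturbation alone.\<close>
    have "norm x \<le> K * norm (A x + (- B x))" using x by (intro bound) (auto simp: span_neg)
    also have "\<dots> \<le> K * (1 / (2 * K) * norm x)"
      using bspec[OF close x(1)] K by (intro mult_left_mono) (auto simp: norm_minus_commute)
    also have "\<dots> = norm x / 2" using K by simp
    finally show "x = 0" by simp
  qed
qed

text \<open>Replacing each \<open>f\<close> by its \<open>G\<close>-component extends to a linear
  map \<open>\<phi>\<close> that is the identity modulo \<open>W\<close>. Since
  \<open>span F\<close> meets \<open>W\<close> only in 0, \<open>\<phi>\<close> is injective there
  and carries \<open>F\<close> to independent vectors of \<open>span G\<close>.\<close>

lemma card_le_card_complement: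
  fixes F G W :: "'a::real_vector set"
  assumes F: "independent F" and G: "finite G" and W: "subspace W"
    and direct: "\<And>v. v \<in> span F \<Longrightarrow> v \<in> W \<Longrightarrow> v = 0"
    and sum: "\<And>f. f \<in> F \<Longrightarrow> \<exists>w\<in>W. \<exists>g\<in>span G. f = w + g"
  shows "card F \<le> card G"
proof -
  have "\<forall>f\<in>F. \<exists>g. g \<in> span G \<and> f - g \<in> W" using sum by (metis add_diff_cancel_right')
  then obtain g where g: "\<And>f. f \<in> F \<Longrightarrow> g f \<in> span G \<and> f - g f \<in> W" by metis
  obtain \<phi> where \<phi>: "linear \<phi>" "\<And>f. f \<in> F \<Longrightarrow> \<phi> f = g f"
    using linear_independent_extend[OF F, of g] by blast
  interpret \<phi>: linear \<phi> by fact
  have mod: "v - \<phi> v \<in> W" if "v \<in> span F" for v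
    using that
  proof (induction rule: span_induct_alt)
    case base
    then show ?case using W by (simp add: \<phi>.zero subspace_0)
  next
    case (step c x y)
    have "(c *\<^sub>R x + y) - \<phi> (c *\<^sub>R x + y) = c *\<^sub>R (x - \<phi> x) + (y - \<phi> y)"
      by (simp add: \<phi>.add \<phi>.scaleR algebra_simps)
    moreover have "x - \<phi> x \<in> W" using g[OF step(1)] \<phi>(2)[OF step(1)] by simp
    ultimately show ?case using step W by (simp only: subspace_add subspace_scale)
  qed
  have inj: "inj_on \<phi> (span F)"
    unfolding linear_inj_on_iff_eq_0[OF \<phi>(1) subspace_span]
    using mod direct by (metis diff_zero)
  have "independent (\<phi> ` F)" using \<phi>(1) F inj by (rule linear_independent_injective_image)
  moreover have "\<phi> ` F \<subseteq> span G" using g \<phi> by auto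
  ultimately have "card (\<phi> ` F) \<le> card G" using independent_span_bound[OF G] by blast
  moreover have "card (\<phi> ` F) = card F"
    using inj by (intro card_image) (meson inj_on_subset span_superset)
  ultimately show ?thesis by simp
qed

text \<open>A codimension of \<open>W\<close> in \<open>M\<close> above \<open>n\<close> is
  witnessed by \<open>n + 1\<close> vectors independent modulo \<open>W\<close>, chosen one at a
  time: as long as at most \<open>n\<close> are present, some vector of \<open>M\<close> lies
  outside \<open>W + span F\<close>.\<close>

lemma independent_mod_exists:
  fixes W :: "'a::real_vector set"
  assumes W: "subspace W"
    and large: "\<And>F. \<lbrakk>finite F; F \<subseteq> M; card F \<le> n\<rbrakk> \<Longrightarrow> \<exists>y\<in>M. \<forall>w\<in>W. \<forall>f\<in>span F. y \<noteq> w + f"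
    and k: "k \<le> Suc n"
  shows "\<exists>F. finite F \<and> card F = k \<and> F \<subseteq> M \<and> independent F \<and> (\<forall>v\<in>span F. v \<in> W \<longrightarrow> v = 0)"
  using k
proof (induction k)
  case 0
  show ?case by (intro exI[of _ "{}"]) (auto simp: independent_empty)
next
  case (Suc k)
  then obtain F where F: "finite F" "card F = k" "F \<subseteq> M" "independent F"
    and d: "\<And>v. v \<in> span F \<Longrightarrow> v \<in> W \<Longrightarrow> v = 0" by auto
  then obtain a where a: "a \<in> M" "\<And>w f. w \<in> W \<Longrightarrow> f \<in> span F \<Longrightarrow> a \<noteq> w + f"
    using large[of F] Suc.prems by auto
  have "a \<notin> span F" using a(2)[of 0 a] W by (auto simp: subspace_0)
  then have "a \<notin> F" "independent (insert a F)" using F by (auto simp: span_base independent_insertI)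
  moreover have "v = 0" if v: "v \<in> span (insert a F)" "v \<in> W" for v
  proof -
    obtain c where c: "v - c *\<^sub>R a \<in> span F" using v by (auto simp: span_insert)
    have "c = 0"
    proof (rule ccontr)
      assume "c \<noteq> 0"
      then have "a = inverse c *\<^sub>R v + (- inverse c) *\<^sub>R (v - c *\<^sub>R a)" by (simp add: algebra_simps)
      moreover have "inverse c *\<^sub>R v \<in> W" using v W by (simp add: subspace_scale)
      moreover have "(- inverse c) *\<^sub>R (v - c *\<^sub>R a) \<in> span F" using c by (rule span_scale)
      ultimately show False using a(2) by blast
    qed
    then show ?thesis using c d v by simp
  qed
  ultimately show ?case using F a by (intro exI[of _ "insert a F"]) auto
qed

lemma closed_image_if_bounded_below:
  fixes A :: "'a::banach \<Rightarrow> 'a"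
  assumes "bounded_linear A" "closed M" "subspace M" "c > 0" "\<And>x. x \<in> M \<Longrightarrow> c * norm x \<le> norm (A x)"
  shows "closed (A ` M)"
proof -
  have "complete (A ` M)"
    using assms by (intro complete_isometric_image[of c]) (auto simp: complete_eq_closed)
  then show ?thesis by (simp add: complete_eq_closed)
qed

text \<open>All \<open>A t\<close> with \<open>t\<close> in \<open>[0, \<mu>]\<close> are bounded
  below on \<open>M\<close> by the same \<open>c - \<mu>\<close>. Under this bound, having
  codimension at most \<open>card F\<close> is both an open and a closed condition on
  \<open>t\<close>, so it passes from \<open>\<mu>\<close> to 0 by connectedness of the
  interval.\<close>

lemma finite_codim_along_bounded_below_path:
  fixes S :: "'a::banach \<Rightarrow> 'a"
  assumes S: "bounded_linear S" and M: "closed M" "subspace M" "S ` M \<subseteq> M"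
    and below: "\<And>x. x \<in> M \<Longrightarrow> c * norm x \<le> norm (S x)" and \<mu>: "0 \<le> \<mu>" "\<mu> < c"
    and F: "finite F" "F \<subseteq> M" and onto: "\<And>y. y \<in> M \<Longrightarrow> \<exists>x\<in>M. \<exists>f\<in>span F. y = (S x - \<mu> *\<^sub>R x) + f"
  shows "\<exists>F. finite F \<and> F \<subseteq> M \<and> (\<forall>y\<in>M. \<exists>x\<in>M. \<exists>f\<in>span F. y = S x + f)"
proof -
  define A where "A t x = S x - t *\<^sub>R x" for t :: real and x
  define P where "P t \<longleftrightarrow> (\<exists>G. finite G \<and> G \<subseteq> M \<and> card G \<le> card F
      \<and> (\<forall>y\<in>M. \<exists>x\<in>M. \<exists>f\<in>span G. y = A t x + f))" for t
  have A: "bounded_linear (A t)" for t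
    unfolding A_def by (intro bounded_linear_sub S bounded_linear_scaleR_right)
  have AM: "A t ` M \<subseteq> M" for t unfolding A_def using M by (auto intro!: subspace_diff subspace_scale)
  have dist: "norm (A s x - A t x) = \<bar>s - t\<bar> * norm x" for s t x
  proof -
    have "A s x - A t x = (t - s) *\<^sub>R x" by (simp add: A_def algebra_simps)
    then show ?thesis by (simp add: abs_minus_commute)
  qed
  have A_below: "(c - \<mu>) * norm x \<le> norm (A t x)" if "x \<in> M" "t \<in> {0..\<mu>}" for x t
  proof -
    have "norm (S x) \<le> norm (A t x) + norm (t *\<^sub>R x)" unfolding A_def by (metis norm_triangle_sub add.commute)
    moreover have "norm (t *\<^sub>R x) \<le> \<mu> * norm x" using that by (simp add: mult_right_mono)
    ultimately show ?thesis using below[OF that(1)] by (simp add: algebra_simps)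
  qed
  have "\<forall>t\<in>{0..\<mu>}. eventually (\<lambda>s. P t = P s) (at t within {0..\<mu>})"
  proof
    fix t assume t: "t \<in> {0..\<mu>}"
    have "\<exists>e>0. \<forall>s. \<bar>s - t\<bar> < e \<longrightarrow> P t = P s"
    proof (cases "P t")
      case True
      then obtain G where G: "finite G" "G \<subseteq> M" "card G \<le> card F"
        "\<And>y. y \<in> M \<Longrightarrow> \<exists>x\<in>M. \<exists>f\<in>span G. y = A t x + f" unfolding P_def by auto
      obtain e K where e: "e > 0"
        "\<forall>B. bounded_linear B \<longrightarrow> B ` M \<subseteq> M \<longrightarrow> (\<forall>x\<in>M. norm (B x - A t x) \<le> e * norm x)
          \<longrightarrow> (\<forall>y\<in>M. \<exists>x\<in>M. \<exists>f\<in>span G. y = B x + f \<and> norm x \<le> K * norm y)"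
        \<comment> \<open>If \<open>P t\<close> holds, the same complement \<open>G\<close> works
          for all nearby parameters.\<close>
        using complement_stable[OF A M(1,2) AM G(1,2,4)] by blast
      have "P s" if "\<bar>s - t\<bar> < e" for s
      proof -
        have "norm (A s x - A t x) \<le> e * norm x" for x using that by (simp add: dist mult_right_mono)
        then have "\<exists>x\<in>M. \<exists>f\<in>span G. y = A s x + f" if "y \<in> M" for y
          using e(2)[rule_format, OF A AM _ that] by blast
        then show ?thesis using G unfolding P_def by blast
      qed
      then show ?thesis using True e by blast
    next
      case False
      have sub: "subspace (A r ` M)" for r
        using M bounded_linear.linear[OF A] by (simp add: linear_subspace_image)
      have "\<exists>y\<in>M. \<forall>w\<in>A t ` M. \<forall>f\<in>span G. y \<noteq> w + f"
        if "finite G" "G \<subseteq> M" "card G \<le> card F" for G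
      proof -
        have "\<not> (\<forall>y\<in>M. \<exists>x\<in>M. \<exists>f\<in>span G. y = A t x + f)"
          using False that unfolding P_def by (metis (no_types))
        then show ?thesis by blast
      qed
      then obtain H where H: "finite H" "card H = Suc (card F)" "H \<subseteq> M" "independent H"
        "\<And>v. v \<in> span H \<Longrightarrow> v \<in> A t ` M \<Longrightarrow> v = 0"
        using independent_mod_exists[OF sub _ order_refl] by metis
      have inj: "x = 0" if "x \<in> M" "A t x \<in> span H" for x
      proof -
        have "A t x = 0" using H(5) that by blast
        then have "(c - \<mu>) * norm x \<le> 0" using A_below[OF that(1) t] by simp
        then show ?thesis using \<mu> by (simp add: mult_le_0_iff)
      qed
      have cl: "closed (A t ` M)"
        using closed_image_if_bounded_below[OF A M(1,2), of "c - \<mu>"] A_below t \<mu> by simp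
      obtain e where e: "e > 0"
        "\<forall>B. (\<forall>x\<in>M. norm (B x - A t x) \<le> e * norm x) \<longrightarrow> (\<forall>x\<in>M. B x \<in> span H \<longrightarrow> x = 0)"
        using injective_mod_stable[OF A M(1,2) cl H(1) inj] by blast
      have "\<not> P s" if "\<bar>s - t\<bar> < e" for s
      proof
        assume "P s"
        then obtain G where G: "finite G" "card G \<le> card F"
          "\<And>y. y \<in> M \<Longrightarrow> \<exists>x\<in>M. \<exists>f\<in>span G. y = A s x + f" unfolding P_def by auto
        have "norm (A s x - A t x) \<le> e * norm x" for x using that by (simp add: dist mult_right_mono)
        then have "v = 0" if "v \<in> span H" "v \<in> A s ` M" for v
          using e(2)[rule_format, of "A s"] that linear_0[OF bounded_linear.linear[OF A]] by blast
        then have "card H \<le> card G"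
          using card_le_card_complement[OF H(4) G(1) sub[of s]] G(3) H(3) by blast
        then show False using H G by simp
      qed
      then show ?thesis using False e by blast
    qed
    then show "eventually (\<lambda>s. P t = P s) (at t within {0..\<mu>})"
      by (auto simp: eventually_at dist_real_def)
  qed
  then have "P 0 = P \<mu>"
    using connected_local_const[of "{0..\<mu>}" 0 \<mu> P] \<mu> by simp
  moreover have "P \<mu>" unfolding P_def A_def using F onto by blast
  ultimately show ?thesis unfolding P_def A_def by auto
qed

section \<open>Kernels and ranges of powers\<close>

text \<open>The spanning set \<open>F\<close> is thinned to \<open>F'\<close> so that the sum with
  the range becomes direct without shrinking. The sum is the whole space, hence closed, and
  \<open>closed_range_if_direct_sum_closed\<close> applies.\<close>

lemma closed_range_if_finite_codim:
  fixes B :: "'a::banach \<Rightarrow> 'a"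
  assumes B: "bounded_linear B" and F: "finite F" and onto: "\<And>y. \<exists>x. \<exists>f\<in>span F. y = B x + f"
  shows "closed (range B)"
proof -
  have W: "subspace (range B)"
    using bounded_linear.linear[OF B] by (simp add: linear_subspace_image)
  have "\<exists>F'\<subseteq>F. span (range B \<union> F') = span (range B \<union> F) \<and> (\<forall>v\<in>span F'. v \<in> range B \<longrightarrow> v = 0)"
    using F
  proof induction
    case empty
    then show ?case by auto
  next
    case (insert a F)
    then obtain F' where F': "F' \<subseteq> F" "span (range B \<union> F') = span (range B \<union> F)"
      "\<And>v. v \<in> span F' \<Longrightarrow> v \<in> range B \<Longrightarrow> v = 0" by blast
    have eq: "span (range B \<union> insert a F') = span (range B \<union> insert a F)"
      using F'(2) by (simp add: span_insert)
    show ?case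
    proof (cases "a \<in> span (range B \<union> F')")
      case True
      then have "span (range B \<union> insert a F') = span (range B \<union> F')" by (simp add: span_redundant)
      then show ?thesis using eq F' by (intro exI[of _ F']) auto
    next
      case False
      have "v = 0" if v: "v \<in> span (insert a F')" "v \<in> range B" for v
      proof -
        obtain c where c: "v - c *\<^sub>R a \<in> span F'" using v by (auto simp: span_insert)
        have "c = 0"
        proof (rule ccontr)
          assume "c \<noteq> 0"
          then have "a = inverse c *\<^sub>R (v - (v - c *\<^sub>R a))" by (simp add: algebra_simps)
          moreover have "v \<in> span (range B \<union> F')" using v by (simp add: span_base)
          moreover have "v - c *\<^sub>R a \<in> span (range B \<union> F')" using c span_mono[of F' "range B \<union> F'"] by blast
          ultimately show False using False by (metis span_diff span_scale)
        qed
        then show ?thesis using c F'(3) v by simp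
      qed
      then show ?thesis using eq F' by (intro exI[of _ "insert a F'"]) auto
    qed
  qed
  then obtain F' where F': "F' \<subseteq> F" "span (range B \<union> F') = span (range B \<union> F)"
    "\<And>v. v \<in> span F' \<Longrightarrow> v \<in> range B \<Longrightarrow> v = 0" by blast
  have sum: "span (range B \<union> G) = {B x + v | x v. v \<in> span G}" for G
    unfolding span_Un span_eq_iff[THEN iffD2, OF W] by blast
  have "span (range B \<union> F) = UNIV" unfolding sum using onto by blast
  then have "closed {B x + v | x v. v \<in> span F'}" using F'(2) sum[of F'] by simp
  moreover have "closed (span F')" using finite_subset[OF F'(1) F] by (rule closed_span_finite)
  ultimately show ?thesis
    using F'(3) by (intro closed_range_if_direct_sum_closed[OF B _ subspace_span, of F']) auto
qed

lemma finite_dim_subspace: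
  assumes "subspace V" "finite F" "V \<subseteq> span F"
  shows "\<exists>B. finite B \<and> B \<subseteq> V \<and> V = span B"
proof -
  obtain B where B: "B \<subseteq> V" "independent B" "V \<subseteq> span B" using maximal_independent_subset by blast
  then have "finite B" using independent_span_bound[of F B] assms by blast
  moreover have "span B \<subseteq> V" using B assms by (simp add: span_minimal)
  ultimately show ?thesis using B by blast
qed

lemma decreasing_subspaces_stabilize:
  assumes sub: "\<And>k::nat. subspace (V k)" and dec: "\<And>k. V (Suc k) \<subseteq> V k"
    and F: "finite F" "V 0 \<subseteq> span F"
  shows "\<exists>k. \<forall>j\<ge>k. V j = V k"
proof -
  have mono: "V j \<subseteq> V k" if "k \<le> j" for j k using that dec by (simp add: lift_Suc_antimono_le)
  \<comment> \<open>An index of least dimension: a basis of any later space extends to one of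
    \<open>V k\<close>, and by minimality nothing is added.\<close>
  obtain k where k: "\<And>j. dim (V k) \<le> dim (V j)" using ex_has_least_nat[of "\<lambda>_. True" 0 "\<lambda>k. dim (V k)"] by auto
  have "V k \<subseteq> V j" if "k \<le> j" for j
  proof -
    obtain B where B: "B \<subseteq> V j" "independent B" "V j \<subseteq> span B" "card B = dim (V j)" by (rule basis_exists)
    have "B \<subseteq> V k" using B(1) mono[OF \<open>k \<le> j\<close>] by (rule order_trans)
    then obtain C where C: "B \<subseteq> C" "C \<subseteq> V k" "independent C" "V k \<subseteq> span C"
      using B(2) by (rule maximal_independent_subset_extend)
    have "finite C" using independent_span_bound[OF F(1) C(3)] C(2) mono[of 0 k] F(2) by blast
    have "card C = dim (V k)" using C by (intro basis_card_eq_dim) auto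
    then have "card C \<le> card B" using k[of j] B by simp
    then have "B = C" by (rule card_seteq[OF \<open>finite C\<close> C(1)])
    moreover have "span B \<subseteq> V j" using B(1) sub by (rule span_minimal)
    ultimately show ?thesis using C(4) by simp
  qed
  then show ?thesis using mono by blast
qed

text \<open>If \<open>A x\<close> is a limit of vectors \<open>A v\<close> with \<open>v\<close> in
  \<open>V\<close>, the open mapping theorem on \<open>M\<close> moves \<open>x\<close> by an
  arbitrarily small \<open>u\<close> into \<open>V + span F\<close>. This sum is closed, because the
  kernel on \<open>M\<close> is finite-dimensional, so it contains \<open>x\<close>.\<close>

lemma closed_image_closed_subspace:
  fixes A :: "'a::banach \<Rightarrow> 'a"
  assumes A: "bounded_linear A" and M: "closed M" "subspace M" "closed (A ` M)"
    and V: "closed V" "subspace V" "V \<subseteq> M" and F: "finite F" "{x\<in>M. A x = 0} = span F"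
  shows "closed (A ` V)"
proof -
  interpret A: bounded_linear A by fact
  obtain K where K: "K > 0" "\<And>y. y \<in> A ` M \<Longrightarrow> \<exists>x\<in>M. A x = y \<and> norm x \<le> K * norm y"
    using open_mapping_closed_image[OF A M] by blast
  have AM: "subspace (A ` M)" using M A.linear_axioms by (simp add: linear_subspace_image)
  have "closure (A ` V) \<subseteq> A ` V"
  proof
    fix y assume y: "y \<in> closure (A ` V)"
    then have "y \<in> A ` M" using closure_minimal[OF _ M(3)] V by blast
    then obtain x where x: "x \<in> M" "y = A x" by blast
    have "\<exists>z\<in>span (V \<union> F). dist z x < e" if "e > 0" for e
    proof -
      obtain v where v: "v \<in> V" "norm (A v - y) < e / K"
        using y K \<open>e > 0\<close> unfolding closure_approachable dist_norm
        by (metis divide_pos_pos imageE)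
      have "A v - y \<in> A ` M" using v V x AM by (auto intro!: subspace_diff)
      then obtain u where u: "u \<in> M" "A u = A v - y" "norm u \<le> K * norm (A v - y)" using K by blast
      have "K * norm (A v - y) < e" using v K by (simp add: field_simps)
      then have "norm u < e" using u by linarith
      have "A (v - x - u) = 0" using u x by (simp add: A.diff)
      moreover have "v - x - u \<in> M" using v V x u M by (auto intro!: subspace_diff)
      ultimately have "v - x - u \<in> span F" using F by blast
      then have "v - (v - x - u) \<in> span (V \<union> F)"
        using v span_mono[of F "V \<union> F"] by (intro span_diff[of v]) (auto simp: span_base simp del: diff_diff_eq)
      then have "x + u \<in> span (V \<union> F)" by (simp add: algebra_simps)
      then show ?thesis using \<open>norm u < e\<close> by (intro bexI[of _ "x + u"]) (auto simp: dist_norm)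
    qed
    then have "x \<in> closure (span (V \<union> F))" by (simp add: closure_approachable)
    then have "x \<in> span (V \<union> F)" using closed_span_Un_finite[OF V(1,2) F(1)] by simp
    then obtain v f where vf: "x = v + f" "v \<in> V" "f \<in> span F"
      unfolding span_Un span_eq_iff[THEN iffD2, OF V(2)] by blast
    then have "A f = 0" using F by blast
    then show "y \<in> A ` V" using vf x by (simp add: A.add)
  qed
  then show ?thesis by (simp add: closure_subset_eq)
qed

section \<open>Ranges and kernels of the powers of one operator\<close>

lemma linear_funpow:
  fixes S :: "'a::real_vector \<Rightarrow> 'a"
  assumes "linear S"
  shows "linear (S ^^ n)"
proof (induction n)
  case 0
  then show ?case using linear_id by (simp add: id_def)
next
  case (Suc n)
  then show ?case using linear_compose[OF Suc assms] by (simp only: funpow.simps)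
qed

lemma bounded_linear_funpow:
  fixes S :: "'a::real_normed_vector \<Rightarrow> 'a"
  assumes "bounded_linear S"
  shows "bounded_linear (S ^^ n)"
proof (induction n)
  case 0
  then show ?case by (simp add: id_def bounded_linear_ident)
next
  case (Suc n)
  then show ?case using bounded_linear_compose[OF assms Suc] by (simp add: o_def)
qed

lemma subspace_range_funpow:
  fixes S :: "'a::real_normed_vector \<Rightarrow> 'a"
  assumes "bounded_linear S"
  shows "subspace (range (S ^^ n))"
  using bounded_linear.linear[OF bounded_linear_funpow[OF assms]] by (simp add: linear_subspace_image)

lemma image_range_funpow:
  fixes S :: "'a \<Rightarrow> 'a"
  shows "S ` range (S ^^ n) = range (S ^^ Suc n)"
  by (auto simp: image_comp)

lemma range_funpow_mono:
  fixes S :: "'a \<Rightarrow> 'a"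
  assumes "m \<le> n"
  shows "range (S ^^ n) \<subseteq> range (S ^^ m)"
proof -
  have "S ^^ n = S ^^ m \<circ> S ^^ (n - m)" using assms by (simp flip: funpow_add)
  then show ?thesis by auto
qed

lemma finite_dim_kernel_funpow:
  fixes S :: "'a::real_vector \<Rightarrow> 'a"
  assumes S: "linear S" and F: "finite F" "{x. S x = 0} = span F"
  shows "\<exists>G. finite G \<and> {x. (S ^^ n) x = 0} = span G"
proof (induction n)
  case 0
  then show ?case by (intro exI[of _ "{}"]) auto
next
  case (Suc n)
  interpret S: linear S by fact
  obtain G where G: "finite G" "{x. (S ^^ n) x = 0} = span G" using Suc by blast
  have eq: "{x. (S ^^ Suc n) x = 0} = {x. S x \<in> span G}"
  proof -
    have "(S ^^ Suc n) x = (S ^^ n) (S x)" for x by (simp add: funpow_swap1)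
    moreover have "(S ^^ n) z = 0 \<longleftrightarrow> z \<in> span G" for z using G(2) by blast
    ultimately show ?thesis by simp
  qed
  have sub: "subspace (span G \<inter> range S)" using S by (intro subspace_inter subspace_span) (simp add: linear_subspace_image)
  obtain B where B: "finite B" "span G \<inter> range S = span B"
    using finite_dim_subspace[OF sub G(1) Int_lower1] by blast
  then have "B \<subseteq> range S" using span_superset by blast
  \<comment> \<open>\<open>C\<close> lifts a spanning set of \<open>N(S ^^ n) \<inter> R(S)\<close>;
    together with \<open>F\<close>, which spans \<open>N(S)\<close>, it spans
    \<open>N(S ^^ Suc n)\<close>.\<close>
  then obtain C where C: "finite C" "B = S ` C" using finite_subset_image[OF B(1)] by blast
  have "{x. S x \<in> span G} \<subseteq> span (F \<union> C)"
  proof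
    fix x assume "x \<in> {x. S x \<in> span G}"
    then have "S x \<in> span G \<inter> range S" by simp
    then have "S x \<in> span (S ` C)" unfolding B(2) C(2) .
    then obtain z where z: "z \<in> span C" "S x = S z" unfolding linear_span_image[OF S] by blast
    then have "x - z \<in> span F" using F by (auto simp: S.diff)
    then show "x \<in> span (F \<union> C)" using z unfolding span_Un
      by (intro CollectI exI[of _ "x - z"] exI[of _ z]) auto
  qed
  moreover have "subspace {x. S x \<in> span G}" using S by (rule linear_subspace_vimage[of S "span G", unfolded vimage_def]) simp
  ultimately show ?case unfolding eq using finite_dim_subspace F C by (metis finite_Un)
qed

lemma closed_range_funpow:
  fixes S :: "'a::banach \<Rightarrow> 'a"
  assumes S: "bounded_linear S" and M: "closed (range (S ^^ n))" "closed (S ` range (S ^^ n))"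
    and F: "finite F" "{x \<in> range (S ^^ n). S x = 0} = span F" and "n \<le> m"
  shows "closed (range (S ^^ m))"
  using \<open>n \<le> m\<close>
proof (induction m rule: dec_induct)
  case base
  then show ?case by fact
next
  case (step m)
  then show ?case
    using closed_image_closed_subspace[OF S M(1) subspace_range_funpow[OF S] M(2) step.IH
        subspace_range_funpow[OF S] range_funpow_mono F] by (simp only: image_range_funpow)
qed

text \<open>The preimage of \<open>R(S ^^ Suc k)\<close> under \<open>S\<close> is
  \<open>R(S ^^ k) + N(S)\<close>, which is therefore closed. The hypothesis on kernels says that
  this sum is direct, so the first summand is closed.\<close>

lemma closed_range_funpow_pred:
  fixes S :: "'a::banach \<Rightarrow> 'a"
  assumes S: "bounded_linear S" and cl: "closed (range (S ^^ Suc k))"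
    and inj: "\<And>x. (S ^^ Suc k) x = 0 \<Longrightarrow> (S ^^ k) x = 0"
  shows "closed (range (S ^^ k))"
proof (rule closed_range_if_direct_sum_closed[OF bounded_linear_funpow[OF S], of "{x. S x = 0}"])
  interpret S: bounded_linear S by fact
  have cont: "continuous_on UNIV S" by (rule S.continuous_on) simp
  have "{x. S x = 0} = S -` {0}" by auto
  then show "closed {x. S x = 0}" using cont by (simp add: closed_vimage)
  show "subspace {x. S x = 0}" using S.linear_axioms by (rule linear_subspace_kernel)
  have "{(S ^^ k) x + v | x v. v \<in> {x. S x = 0}} = S -` range (S ^^ Suc k)"
  proof (intro subset_antisym subsetI)
    fix y assume "y \<in> {(S ^^ k) x + v | x v. v \<in> {x. S x = 0}}"
    then show "y \<in> S -` range (S ^^ Suc k)" by (auto simp: S.add)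
  next
    fix y assume "y \<in> S -` range (S ^^ Suc k)"
    then obtain x where "S y = (S ^^ Suc k) x" by blast
    then have "S (y - (S ^^ k) x) = 0" by (simp add: S.diff)
    then show "y \<in> {(S ^^ k) x + v | x v. v \<in> {x. S x = 0}}"
      by (intro CollectI exI[of _ x] exI[of _ "y - (S ^^ k) x"]) simp
  qed
  then show "closed {(S ^^ k) x + v | x v. v \<in> {x. S x = 0}}" using closed_vimage[OF cl cont] by simp
  show "(S ^^ k) x = 0" if "(S ^^ k) x \<in> {x. S x = 0}" for x using inj that by simp
qed

lemma funpow_shift_commute:
  fixes S :: "'a::real_vector \<Rightarrow> 'a"
  assumes "linear S"
  shows "(S ^^ k) (S x - \<mu> *\<^sub>R x) = S ((S ^^ k) x) - \<mu> *\<^sub>R (S ^^ k) x"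
  using linear_funpow[OF assms, of k] by (simp add: linear_diff linear_cmul funpow_swap1)

text \<open>This and the next lemma replace the Bezout identity for the coprime polynomials
  \<open>z ^ k\<close> and \<open>z - \<mu>\<close>, evaluated at \<open>S\<close>.\<close>

lemma norm_le_shift_plus_funpow:
  fixes S :: "'a::real_normed_vector \<Rightarrow> 'a"
  assumes S: "bounded_linear S" and \<mu>: "\<mu> > 0"
  shows "\<exists>C\<ge>0. \<forall>x. norm x \<le> C * (norm (S x - \<mu> *\<^sub>R x) + norm ((S ^^ k) x))"
proof (induction k)
  case 0
  then show ?case by (intro exI[of _ 1]) auto
next
  case (Suc k)
  then obtain C where C: "C \<ge> 0" "\<And>x. norm x \<le> C * (norm (S x - \<mu> *\<^sub>R x) + norm ((S ^^ k) x))" by blast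
  obtain L where L: "L > 0" "\<And>x. norm ((S ^^ k) x) \<le> norm x * L"
    using bounded_linear.pos_bounded[OF bounded_linear_funpow[OF S]] by blast
  show ?case
  proof (intro exI[of _ "C * (1 + (1 + L) / \<mu>)"] conjI allI)
    show "0 \<le> C * (1 + (1 + L) / \<mu>)" using C L \<mu> by simp
    fix x
    let ?b = "norm (S x - \<mu> *\<^sub>R x)" and ?s = "norm ((S ^^ Suc k) x)"
    have "\<mu> *\<^sub>R (S ^^ k) x = (S ^^ Suc k) x - (S ^^ k) (S x - \<mu> *\<^sub>R x)"
      using funpow_shift_commute[OF bounded_linear.linear[OF S]] by simp
    then have "\<mu> * norm ((S ^^ k) x) = norm ((S ^^ Suc k) x - (S ^^ k) (S x - \<mu> *\<^sub>R x))"
      using \<mu> by (metis abs_of_pos norm_scaleR)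
    also have "\<dots> \<le> ?s + ?b * L"
      using norm_triangle_ineq4 L(2)[of "S x - \<mu> *\<^sub>R x"] by (rule order_trans[OF _ add_left_mono])
    also have "\<dots> \<le> (1 + L) * (?b + ?s)" using L by (simp add: algebra_simps)
    finally have "norm ((S ^^ k) x) \<le> (1 + L) / \<mu> * (?b + ?s)" using \<mu> by (simp add: field_simps)
    then have "?b + norm ((S ^^ k) x) \<le> (1 + (1 + L) / \<mu>) * (?b + ?s)"
      using norm_ge_zero[of "(S ^^ Suc k) x"] unfolding distrib_right[of 1] mult_1_left by linarith
    then have "C * (?b + norm ((S ^^ k) x)) \<le> C * ((1 + (1 + L) / \<mu>) * (?b + ?s))"
      using C(1) by (rule mult_left_mono)
    then show "norm x \<le> C * (1 + (1 + L) / \<mu>) * (?b + ?s)" using C(2)[of x] by (simp add: mult.assoc)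
  qed
qed

lemma range_shift_plus_range_funpow:
  fixes S :: "'a::real_vector \<Rightarrow> 'a"
  assumes S: "linear S" and \<mu>: "\<mu> \<noteq> 0"
  shows "\<exists>v u. y = (S v - \<mu> *\<^sub>R v) + (S ^^ k) u"
proof (induction k)
  case 0
  have "y = (S 0 - \<mu> *\<^sub>R 0) + (S ^^ 0) y" using S by (simp add: linear_0)
  then show ?case by blast
next
  case (Suc k)
  interpret S: linear S by fact
  obtain v u where vu: "y = (S v - \<mu> *\<^sub>R v) + (S ^^ k) u" using Suc by blast
  \<comment> \<open>Uses \<open>S ^^ k u = inverse \<mu> (S ^^ Suc k u - (S - \<mu>) (S ^^ k
    u))\<close>: the second term is absorbed into \<open>w\<close>.\<close>
  define w where "w = v - inverse \<mu> *\<^sub>R (S ^^ k) u"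
  have "(S ^^ Suc k) (inverse \<mu> *\<^sub>R u) = inverse \<mu> *\<^sub>R S ((S ^^ k) u)"
    using linear_cmul[OF linear_funpow[OF S]] by (simp add: S.scaleR)
  then have "(S w - \<mu> *\<^sub>R w) + (S ^^ Suc k) (inverse \<mu> *\<^sub>R u) = y"
    unfolding vu w_def using \<mu> by (simp add: S.diff S.scaleR algebra_simps)
  then show ?case by metis
qed

section \<open>Complex and real dimension\<close>

interpretation cv: vector_space "scaleC :: complex \<Rightarrow> 'a \<Rightarrow> 'a::complex_vector"
  by standard (simp_all add: scaleC_add_right scaleC_add_left scaleC_scaleC scaleC_one)

lemma cspan_eq_cv_span: "cspan S = cv.span S"
  unfolding cspan_def cv.span_explicit by blast

lemma scaleC_eq_Re_Im: "scaleC c x = Re c *\<^sub>R x + Im c *\<^sub>R scaleC \<i> x"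
  by (simp add: scaleR_scaleC scaleC_scaleC scaleC_add_left[symmetric] complex_eq mult.commute)

text \<open>The bridge to the preceding sections, which work with real spans throughout: doubling a
  generating set by multiplication with the imaginary unit keeps it finite, so finite dimension and
  finite codimension mean the same over both fields.\<close>

lemma cspan_eq_real_span: "cspan F = span (F \<union> scaleC \<i> ` F)"
proof
  show "cspan F \<subseteq> span (F \<union> scaleC \<i> ` F)"
    unfolding cspan_def
  proof clarify
    fix G c assume G: "finite G" "G \<subseteq> F"
    have "scaleC (c x) x \<in> span (F \<union> scaleC \<i> ` F)" if "x \<in> G" for x
    proof (subst scaleC_eq_Re_Im, intro span_add span_scale)
      show "x \<in> span (F \<union> scaleC \<i> ` F)" "scaleC \<i> x \<in> span (F \<union> scaleC \<i> ` F)"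
        using that G by (auto intro: span_base)
    qed
    then show "(\<Sum>x\<in>G. scaleC (c x) x) \<in> span (F \<union> scaleC \<i> ` F)"
      by (rule span_sum)
  qed
  have "subspace (cspan F)"
    unfolding cspan_eq_cv_span subspace_def scaleR_scaleC
    by (simp add: cv.span_zero cv.span_add cv.span_scale)
  moreover have "F \<union> scaleC \<i> ` F \<subseteq> cspan F"
    unfolding cspan_eq_cv_span by (auto intro: cv.span_base cv.span_scale)
  ultimately show "span (F \<union> scaleC \<i> ` F) \<subseteq> cspan F" by (rule span_minimal[rotated])
qed

lemma fin_dim_imp_real:
  assumes "fin_dim V"
  shows "\<exists>F. finite F \<and> V = span F"
  using assms unfolding fin_dim_def cspan_eq_real_span by (metis finite_UnI finite_imageI)

lemma fin_dim_if_real: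
  assumes F: "finite F" "V = span F" and V: "\<And>c x. x \<in> V \<Longrightarrow> scaleC c x \<in> V"
  shows "fin_dim V"
proof -
  have sub: "F \<union> scaleC \<i> ` F \<subseteq> V" using F V by (auto simp: span_base)
  have "subspace V" using F by simp
  then have "cspan F \<subseteq> V" unfolding cspan_eq_real_span by (rule span_minimal[OF sub])
  moreover have "V \<subseteq> cspan F" unfolding cspan_eq_real_span F(2) by (intro span_mono) auto
  ultimately show ?thesis using F sub unfolding fin_dim_def by (intro exI[of _ F]) auto
qed

lemma fin_codim_in_imp_real:
  assumes cod: "fin_codim_in M W" and M: "\<And>c x. x \<in> M \<Longrightarrow> scaleC c x \<in> M"
  shows "\<exists>F. finite F \<and> F \<subseteq> M \<and> (\<forall>y\<in>M. \<exists>v\<in>W. \<exists>z\<in>span F. y = v + z)"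
proof -
  obtain F where F: "finite F" "F \<subseteq> M" "\<forall>y\<in>M. \<exists>v\<in>W. \<exists>z\<in>cspan F. y = v + z"
    using cod unfolding fin_codim_in_def by blast
  then have "finite (F \<union> scaleC \<i> ` F)" "F \<union> scaleC \<i> ` F \<subseteq> M" using M by auto
  then show ?thesis using F(3) unfolding cspan_eq_real_span by blast
qed

lemma fin_codim_in_if_real:
  assumes "finite F" "F \<subseteq> M" "\<And>y. y \<in> M \<Longrightarrow> \<exists>v\<in>W. \<exists>z\<in>span F. y = v + z"
  shows "fin_codim_in M W"
proof -
  have sub: "span F \<subseteq> cspan F" unfolding cspan_eq_real_span by (intro span_mono) auto
  show ?thesis
    unfolding fin_codim_in_def
  proof (intro exI[of _ F] conjI ballI)
    fix y assume "y \<in> M"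
    then obtain v z where "v \<in> W" "z \<in> span F" "y = v + z" using assms(3) by blast
    then show "\<exists>v\<in>W. \<exists>z\<in>cspan F. y = v + z" using sub by blast
  qed (use assms in auto)
qed

section \<open>Fredholm, Browder, B-Fredholm and left Drazin invertible operators\<close>

lemma bcl_bounded_linear: "bcl S \<Longrightarrow> bounded_linear S"
  by (simp add: bcl_def)

lemma bcl_scaleC: "bcl S \<Longrightarrow> S (scaleC c x) = scaleC c (S x)"
  by (simp add: bcl_def)

lemma bcl_funpow_scaleC:
  assumes "bcl S"
  shows "(S ^^ n) (scaleC c x) = scaleC c ((S ^^ n) x)"
  by (induction n) (auto simp: bcl_scaleC[OF assms])

lemma scaleC_range_funpow:
  assumes "bcl S" "x \<in> range (S ^^ n)"
  shows "scaleC c x \<in> range (S ^^ n)"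
  using assms(2) by (auto simp: bcl_funpow_scaleC[OF assms(1), symmetric])

lemma bcl_shift:
  fixes T :: "'a::complex_normed_vector \<Rightarrow> 'a"
  assumes "bcl T"
  shows "bcl (shift T l)"
proof -
  have "bounded_linear (\<lambda>x::'a. scaleC l x)"
  proof (rule bounded_linear_intro[where K = "cmod l"])
    show "scaleC l (r *\<^sub>R x) = r *\<^sub>R scaleC l x" for r and x :: 'a
      by (simp add: scaleR_scaleC scaleC_scaleC mult.commute)
  qed (simp_all add: scaleC_add_right norm_scaleC mult.commute)
  then show ?thesis
    using assms unfolding bcl_def shift_def
    by (auto intro: bounded_linear_sub simp: cv.scale_right_diff_distrib scaleC_scaleC mult.commute)
qed

lemma shift_of_real: "shift S (complex_of_real \<mu>) x = S x - \<mu> *\<^sub>R x"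
  by (simp add: shift_def scaleR_scaleC)

lemma shift_shift: "shift (shift T l) m = shift T (l + m)"
  by (simp add: shift_def fun_eq_iff scaleC_add_left algebra_simps)

section \<open>Pointwise relations between the four classes of operators\<close>

lemma fredholm_eq: "fredholm S \<longleftrightarrow> closed (range S) \<and> fin_dim (nullsp S) \<and> fin_codim_in UNIV (range S)"
  by (simp add: fredholm_def fredholm_on_def nullsp_def)

lemma funpow_eq_0_descend:
  assumes asc: "nullsp (S ^^ p) = nullsp (S ^^ Suc p)" and "p \<le> k" and "(S ^^ Suc k) x = 0"
  shows "(S ^^ k) x = 0"
proof -
  obtain j where k: "k = p + j" using \<open>p \<le> k\<close> le_Suc_ex by blast
  have "(S ^^ j) x \<in> nullsp (S ^^ Suc p)"
    using assms(3) unfolding nullsp_def k add_Suc[symmetric] funpow_add by simp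
  then have "(S ^^ j) x \<in> nullsp (S ^^ p)" using asc by simp
  then show ?thesis unfolding nullsp_def k funpow_add by simp
qed

lemma nullsp_ascent:
  assumes "finite_ascent S"
  shows "nullsp (S ^^ ascent S) = nullsp (S ^^ Suc (ascent S))"
  using assms unfolding finite_ascent_def ascent_def by (rule LeastI_ex)

text \<open>Closedness descends from high powers to the power \<open>Suc (ascent S)\<close>: beyond
  the ascent the kernels no longer grow, so \<open>closed_range_funpow_pred\<close> applies at each
  step down.\<close>

lemma left_drazin_if_closed_range:
  fixes S :: "'a::{complex_normed_vector, banach} \<Rightarrow> 'a"
  assumes S: "bcl S" and asc: "finite_ascent S" and cl: "\<And>m. n \<le> m \<Longrightarrow> closed (range (S ^^ m))"
  shows "left_drazin S"
proof -
  have "closed (range (S ^^ m))" if "Suc (ascent S) \<le> m" "m \<le> max n (Suc (ascent S))" for m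
    using that(2,1)
  proof (induction m rule: inc_induct)
    case base
    then show ?case using cl by simp
  next
    case (step m)
    then show ?case
      using closed_range_funpow_pred[OF bcl_bounded_linear[OF S]] funpow_eq_0_descend[OF nullsp_ascent[OF asc]]
      by (meson Suc_leD le_SucI)
  qed
  from this[of "Suc (ascent S)"] show ?thesis unfolding left_drazin_def using asc by simp
qed

lemma upper_semi_browder_imp_left_drazin:
  fixes S :: "'a::{complex_normed_vector, banach} \<Rightarrow> 'a"
  assumes S: "bcl S" and "upper_semi_browder S"
  shows "left_drazin S"
proof (rule left_drazin_if_closed_range[OF S])
  show "finite_ascent S" using assms by (simp add: upper_semi_browder_def)
  have "closed (range S)" "fin_dim (nullsp S)"
    using assms by (auto simp: upper_semi_browder_def upper_semi_fredholm_def)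
  moreover then obtain F where "finite F" "nullsp S = span F" using fin_dim_imp_real by blast
  ultimately show "closed (range (S ^^ m))" if "0 \<le> m" for m
    using closed_range_funpow[OF bcl_bounded_linear[OF S], of 0 F m] by (simp add: nullsp_def)
qed

text \<open>\<open>S ^^ n\<close> induces an isomorphism of \<open>X / (R(S) + N(S ^^ n))\<close> onto \<open>R(S ^^ n) / R(S ^^ Suc n)\<close>,
  and \<open>N(S ^^ n)\<close> is finite-dimensional along with \<open>N(S)\<close>.\<close>

lemma fredholm_if_upper_semi_fredholm_b_fredholm:
  fixes S :: "'a::{complex_normed_vector, banach} \<Rightarrow> 'a"
  assumes S: "bcl S" and usf: "upper_semi_fredholm S" and bf: "b_fredholm S"
  shows "fredholm S"
proof -
  have lin: "linear S" using bcl_bounded_linear[OF S] by (rule bounded_linear.linear)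
  obtain n where "fin_codim_in (range (S ^^ n)) (S ` range (S ^^ n))"
    using bf unfolding b_fredholm_def fredholm_on_def by blast
  then obtain F where F: "finite F" "F \<subseteq> range (S ^^ n)"
    "\<forall>y\<in>range (S ^^ n). \<exists>v\<in>S ` range (S ^^ n). \<exists>z\<in>span F. y = v + z"
    using fin_codim_in_imp_real scaleC_range_funpow[OF S] by metis
  \<comment> \<open>\<open>C\<close> consists of preimages under \<open>S ^^ n\<close> of the
    complement \<open>F\<close>. Once \<open>S v\<close> and a vector of \<open>span C\<close> are
    subtracted from \<open>y\<close>, the rest lies in \<open>N(S ^^ n)\<close>, which
    \<open>G\<close> spans.\<close>
  obtain C where C: "finite C" "F = (S ^^ n) ` C" using finite_subset_image[OF F(1,2)] by blast
  obtain F0 where "finite F0" "{x. S x = 0} = span F0"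
    using usf fin_dim_imp_real unfolding upper_semi_fredholm_def nullsp_def by blast
  then obtain G where G: "finite G" "{x. (S ^^ n) x = 0} = span G"
    using finite_dim_kernel_funpow[OF lin] by blast
  have "fin_codim_in UNIV (range S)"
  proof (rule fin_codim_in_if_real)
    show "finite (C \<union> G)" using C G by simp
    fix y
    obtain v z where vz: "z \<in> span F" "(S ^^ n) y = S ((S ^^ n) v) + z" using F(3) by blast
    then obtain g where g: "g \<in> span C" "z = (S ^^ n) g"
      unfolding C(2) linear_span_image[OF linear_funpow[OF lin]] by blast
    have "(S ^^ n) (y - S v - g) = 0"
      using vz g linear_funpow[OF lin] by (simp add: linear_diff funpow_swap1)
    then have "y - S v - g \<in> span G" using G by blast
    then have "g + (y - S v - g) \<in> span (C \<union> G)" using g unfolding span_Un by blast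
    then show "\<exists>v\<in>range S. \<exists>z\<in>span (C \<union> G). y = v + z"
      by (intro bexI[of _ "S v"] bexI[of _ "y - S v"]) auto
  qed simp
  then show ?thesis using usf by (simp add: fredholm_eq upper_semi_fredholm_def)
qed

lemma left_drazin_perturbation:
  fixes S :: "'a::{complex_normed_vector, banach} \<Rightarrow> 'a"
  assumes S: "bcl S" and ld: "left_drazin S"
  shows "\<exists>e>0. \<forall>\<mu>. 0 < \<mu> \<longrightarrow> \<mu> < e \<longrightarrow> upper_semi_browder (shift S (complex_of_real \<mu>))
    \<and> (fredholm (shift S (complex_of_real \<mu>)) \<longrightarrow> b_fredholm S)"
proof -
  have bl: "bounded_linear S" using S by (rule bcl_bounded_linear)
  interpret S: bounded_linear S by fact
  define p where "p = ascent S"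
  define M where "M = range (S ^^ p)"
  have inj: "(S ^^ p) x = 0" if "(S ^^ Suc p) x = 0" for x
    using ld funpow_eq_0_descend[OF nullsp_ascent, of S p x] that by (simp add: left_drazin_def p_def)
  have clS: "closed (range (S ^^ Suc p))" using ld by (simp only: left_drazin_def p_def)
  have SM: "S ` M = range (S ^^ Suc p)" unfolding M_def by (rule image_range_funpow)
  have M: "closed M" "subspace M" "S ` M \<subseteq> M"
    using closed_range_funpow_pred[OF bl clS inj] subspace_range_funpow[OF bl] SM range_funpow_mono[of p "Suc p" S]
    by (simp_all add: M_def)
  have injM: "x = 0" if "x \<in> M" "S x = 0" for x using that inj unfolding M_def by auto
  have clSM: "closed (S ` M)" using clS SM by simp
  obtain K where K: "K > 0" "\<And>y. y \<in> S ` M \<Longrightarrow> \<exists>x\<in>M. S x = y \<and> norm x \<le> K * norm y"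
    using open_mapping_closed_image[OF bl M(1,2) clSM] by blast
  \<comment> \<open>The lower bound of \<open>S\<close> on \<open>M\<close>; it is also the range
    allowed for \<open>\<mu>\<close>, leaving \<open>c - \<mu>\<close> for the shifted
    operator.\<close>
  define c where "c = 1 / K"
  have below: "c * norm x \<le> norm (S x)" if x: "x \<in> M" for x
  proof -
    obtain u where u: "u \<in> M" "S u = S x" "norm u \<le> K * norm (S x)" using K(2)[of "S x"] x by blast
    then have "u = x" using injM[of "u - x"] x M by (simp add: subspace_diff S.diff)
    then show ?thesis using u K by (simp add: c_def field_simps)
  qed
  show ?thesis
  proof (intro exI[of _ c] conjI allI impI)
    show "c > 0" using K by (simp add: c_def)
    fix \<mu> :: real assume \<mu>: "0 < \<mu>" "\<mu> < c"
    define B where "B = shift S (complex_of_real \<mu>)"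
    have B: "B x = S x - \<mu> *\<^sub>R x" for x by (simp add: B_def shift_of_real)
    have blB: "bounded_linear B" unfolding B_def using S by (intro bcl_bounded_linear bcl_shift)
    have comm: "(S ^^ p) (B x) = B ((S ^^ p) x)" for x
      unfolding B using S.linear_axioms by (rule funpow_shift_commute)
    have BM: "(c - \<mu>) * norm x \<le> norm (B x)" if "x \<in> M" for x
    proof -
      have "norm (S x) \<le> norm (B x) + norm (\<mu> *\<^sub>R x)" unfolding B by (metis norm_triangle_sub add.commute)
      then show ?thesis using below[OF that] \<mu> by (simp add: algebra_simps)
    qed
    obtain C where C: "C \<ge> 0" "\<And>x. norm x \<le> C * (norm (B x) + norm ((S ^^ p) x))"
      using norm_le_shift_plus_funpow[OF bl \<mu>(1), of p] unfolding B by blast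
    obtain L where L: "L > 0" "\<And>x. norm ((S ^^ p) x) \<le> norm x * L"
      using bounded_linear.pos_bounded[OF bounded_linear_funpow[OF bl]] by blast
    \<comment> \<open>Obtained by substituting the estimate of \<open>norm ((S ^^ p) x)\<close> by
      \<open>norm (B x)\<close> into \<open>C(2)\<close>; the added 1 makes \<open>D\<close>
      positive even if \<open>C = 0\<close>.\<close>
    define D where "D = C * (1 + L / (c - \<mu>)) + 1"
    have "0 \<le> C * (1 + L / (c - \<mu>))" using C L \<mu> by simp
    then have "D > 0" by (simp add: D_def)
    have BX: "1 / D * norm x \<le> norm (B x)" for x
    proof -
      have "(c - \<mu>) * norm ((S ^^ p) x) \<le> norm (B ((S ^^ p) x))" using BM[of "(S ^^ p) x"] by (simp add: M_def)
      also have "\<dots> \<le> norm (B x) * L" using L(2)[of "B x"] by (simp add: comm)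
      finally have "norm ((S ^^ p) x) \<le> L / (c - \<mu>) * norm (B x)" using \<mu> by (simp add: field_simps)
      then have "norm (B x) + norm ((S ^^ p) x) \<le> (1 + L / (c - \<mu>)) * norm (B x)"
        by (simp add: distrib_right)
      then have "C * (norm (B x) + norm ((S ^^ p) x)) \<le> C * ((1 + L / (c - \<mu>)) * norm (B x))"
        using C(1) by (rule mult_left_mono)
      also have "\<dots> \<le> D * norm (B x)" by (simp add: D_def algebra_simps)
      finally have "norm x \<le> D * norm (B x)" using C(2)[of x] by linarith
      then show ?thesis using \<open>D > 0\<close> by (simp add: field_simps)
    qed
    have ker: "nullsp B = {0}"
    proof -
      have "x = 0" if "B x = 0" for x using BX[of x] that \<open>D > 0\<close> by (simp add: divide_le_0_iff)
      then show ?thesis using linear_0[OF bounded_linear.linear[OF blB]] by (auto simp: nullsp_def)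
    qed
    have "closed (range B)"
      using closed_image_if_bounded_below[OF blB closed_UNIV subspace_UNIV, of "1 / D"] BX \<open>D > 0\<close> by simp
    moreover have "fin_dim (nullsp B)" unfolding ker by (rule fin_dim_if_real[of "{}"]) auto
    moreover have "finite_ascent B"
      unfolding finite_ascent_def by (rule exI[of _ 0]) (use ker in \<open>simp add: nullsp_def\<close>)
    ultimately show "upper_semi_browder B" unfolding upper_semi_browder_def upper_semi_fredholm_def by blast
    assume "fredholm B"
    then have "fin_codim_in UNIV (range B)" by (simp add: fredholm_eq)
    then obtain F where F: "finite F" "\<forall>y. \<exists>v\<in>range B. \<exists>z\<in>span F. y = v + z"
      using fin_codim_in_imp_real[OF _ UNIV_I] by force
    have "\<exists>x\<in>M. \<exists>f\<in>span ((S ^^ p) ` F). y = (S x - \<mu> *\<^sub>R x) + f" if y: "y \<in> M" for y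
    proof -
      obtain u where u: "y = (S ^^ p) u" using y unfolding M_def by blast
      obtain v z where vz: "z \<in> span F" "u = B v + z" using F(2) by blast
      have linp: "linear (S ^^ p)" using S.linear_axioms by (rule linear_funpow)
      have "y = B ((S ^^ p) v) + (S ^^ p) z" unfolding u vz(2) by (simp add: linear_add[OF linp] comm)
      moreover have "(S ^^ p) z \<in> span ((S ^^ p) ` F)" using vz(1) linear_span_image[OF linp] by blast
      moreover have "(S ^^ p) v \<in> M" by (simp add: M_def)
      ultimately show ?thesis unfolding B by blast
    qed
    then obtain G where G: "finite G" "G \<subseteq> M" "\<forall>y\<in>M. \<exists>x\<in>M. \<exists>f\<in>span G. y = S x + f"
      using finite_codim_along_bounded_below_path[OF bl M below less_imp_le[OF \<mu>(1)] \<mu>(2), of "(S ^^ p) ` F"] F(1)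
      by (auto simp: M_def)
    have "fin_codim_in M (S ` M)" by (rule fin_codim_in_if_real[OF G(1,2)]) (use G(3) in blast)
    moreover have "{x \<in> M. S x = 0} = {0}" using injM subspace_0[OF M(2)] S.zero by blast
    then have "fin_dim {x \<in> M. S x = 0}" using fin_dim_if_real[of "{}" "{x \<in> M. S x = 0}"] by simp
    moreover have "closedin (top_of_set M) (S ` M)" using clSM M(3) by (simp add: closed_subset)
    ultimately show "b_fredholm S"
      unfolding b_fredholm_def fredholm_on_def using M(1) unfolding M_def by blast
  qed
qed

section \<open>Perturbation of B-Fredholm operators\<close>

lemma b_fredholmE:
  fixes S :: "'a::{complex_normed_vector, banach} \<Rightarrow> 'a"
  assumes S: "bcl S" and bf: "b_fredholm S"
  obtains n F G where "closed (range (S ^^ n))" "closed (S ` range (S ^^ n))"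
    "finite F" "{x \<in> range (S ^^ n). S x = 0} = span F"
    "finite G" "G \<subseteq> range (S ^^ n)"
    "\<forall>y\<in>range (S ^^ n). \<exists>x\<in>range (S ^^ n). \<exists>f\<in>span G. y = S x + f"
proof -
  obtain n where n: "closed (range (S ^^ n))" "closedin (top_of_set (range (S ^^ n))) (S ` range (S ^^ n))"
    "fin_dim {x \<in> range (S ^^ n). S x = 0}" "fin_codim_in (range (S ^^ n)) (S ` range (S ^^ n))"
    using bf unfolding b_fredholm_def fredholm_on_def by blast
  have cl: "closed (S ` range (S ^^ n))" using n(2,1) by (rule closedin_closed_trans)
  obtain F where F: "finite F" "{x \<in> range (S ^^ n). S x = 0} = span F"
    using fin_dim_imp_real[OF n(3)] by blast
  obtain G where G: "finite G" "G \<subseteq> range (S ^^ n)"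
    "\<forall>y\<in>range (S ^^ n). \<exists>v\<in>S ` range (S ^^ n). \<exists>z\<in>span G. y = v + z"
    using fin_codim_in_imp_real[OF n(4) scaleC_range_funpow[OF S]] by blast
  have onto: "\<forall>y\<in>range (S ^^ n). \<exists>x\<in>range (S ^^ n). \<exists>f\<in>span G. y = S x + f"
    using G(3) by simp
  show ?thesis by (rule that[OF n(1) cl F G(1,2) onto])
qed

lemma b_fredholm_imp_fredholm_shift:
  fixes S :: "'a::{complex_normed_vector, banach} \<Rightarrow> 'a"
  assumes S: "bcl S" and bf: "b_fredholm S"
  shows "\<exists>e>0. \<forall>\<mu>. 0 < \<mu> \<longrightarrow> \<mu> < e \<longrightarrow> fredholm (shift S (complex_of_real \<mu>))"
proof -
  have bl: "bounded_linear S" using S by (rule bcl_bounded_linear)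
  interpret S: bounded_linear S by fact
  obtain n F G where *: "closed (range (S ^^ n))" "closed (S ` range (S ^^ n))"
    "finite F" "{x \<in> range (S ^^ n). S x = 0} = span F"
    "finite G" "G \<subseteq> range (S ^^ n)"
    "\<forall>y\<in>range (S ^^ n). \<exists>x\<in>range (S ^^ n). \<exists>f\<in>span G. y = S x + f"
    by (rule b_fredholmE[OF S bf])
  define M where "M = range (S ^^ n)"
  note * = *[folded M_def]
  have M: "subspace M" "S ` M \<subseteq> M"
    using subspace_range_funpow[OF bl] image_range_funpow[of S n] range_funpow_mono[of n "Suc n" S]
    by (simp_all add: M_def)
  obtain e K where e: "e > 0" "\<forall>B. bounded_linear B \<longrightarrow> B ` M \<subseteq> M \<longrightarrow> (\<forall>x\<in>M. norm (B x - S x) \<le> e * norm x)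
      \<longrightarrow> (\<forall>y\<in>M. \<exists>x\<in>M. \<exists>f\<in>span G. y = B x + f \<and> norm x \<le> K * norm y)"
    using complement_stable[OF bl *(1) M *(5,6) bspec[OF *(7)]] by blast
  obtain K' where K': "K' > 0" "\<And>y. y \<in> S ` M \<Longrightarrow> \<exists>x\<in>M. S x = y \<and> norm x \<le> K' * norm y"
    using open_mapping_closed_image[OF bl *(1) M(1) *(2)] by blast
  show ?thesis
  \<comment> \<open>The bound \<open>e\<close> serves the codimension; the bound
    \<open>1 / (8 * K')\<close> puts kernel vectors of \<open>B\<close> within relative distance 1/8
    of \<open>span F\<close>.\<close>
  proof (intro exI[of _ "min e (1 / (8 * K'))"] conjI allI impI)
    show "0 < min e (1 / (8 * K'))" using e K' by simp
    fix \<mu> :: real assume \<mu>: "0 < \<mu>" "\<mu> < min e (1 / (8 * K'))"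
    define B where "B = shift S (complex_of_real \<mu>)"
    have B: "B x = S x - \<mu> *\<^sub>R x" for x by (simp add: B_def shift_of_real)
    have bclB: "bcl B" unfolding B_def using S by (rule bcl_shift)
    then have blB: "bounded_linear B" by (rule bcl_bounded_linear)
    have BM: "B ` M \<subseteq> M" using M unfolding B by (auto intro!: subspace_diff subspace_scale)
    have close: "\<forall>x\<in>M. norm (B x - S x) \<le> e * norm x" using \<mu> by (auto simp: B mult_right_mono)
    have onto: "\<exists>x. \<exists>f\<in>span G. y = B x + f" for y
    proof -
      obtain v u where vu: "y = B v + (S ^^ n) u"
        using range_shift_plus_range_funpow[OF S.linear_axioms, of \<mu> y n] \<mu> unfolding B by auto
      have "(S ^^ n) u \<in> M" by (simp add: M_def)
      then obtain x f where xf: "f \<in> span G" "(S ^^ n) u = B x + f"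
        using e(2)[rule_format, OF blB BM] close by blast
      then have "y = B (v + x) + f"
        using vu by (simp add: linear_add[OF bounded_linear.linear[OF blB]] add.assoc)
      then show ?thesis using xf by blast
    qed
    have "closed (range B)" using closed_range_if_finite_codim[OF blB *(5) onto] .
    moreover have "fin_codim_in UNIV (range B)"
      by (rule fin_codim_in_if_real[OF *(5)]) (use onto in blast)+
    moreover have "fin_dim (nullsp B)"
    proof -
      have sub: "subspace (nullsp B)"
        unfolding nullsp_def using bounded_linear.linear[OF blB] by (rule linear_subspace_kernel)
      have near: "\<exists>y\<in>span F. norm (x - y) \<le> 1/8 * norm x" if x: "x \<in> nullsp B" for x
      proof -
        have Sx: "S x = \<mu> *\<^sub>R x" using x by (simp add: nullsp_def B)
        have "(S ^^ k) x = \<mu> ^ k *\<^sub>R x" for k by (induction k) (auto simp: Sx S.scaleR)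
        \<comment> \<open>An eigenvector for the nonzero eigenvalue \<open>\<mu>\<close> lies in the
          range of every power of \<open>S\<close>.\<close>
        then have "x = (S ^^ n) (inverse (\<mu> ^ n) *\<^sub>R x)"
          using \<mu> by (simp add: linear_cmul[OF linear_funpow[OF S.linear_axioms]])
        then have xM: "x \<in> M" unfolding M_def by blast
        \<comment> \<open>\<open>S x = \<mu> x\<close> is small, so it has a small preimage
          \<open>u\<close> in \<open>M\<close>; then \<open>x - u\<close> is in the kernel of
          \<open>S\<close> on \<open>M\<close> and near \<open>x\<close>.\<close>
        then obtain u where u: "u \<in> M" "S u = S x" "norm u \<le> K' * norm (S x)" using K'(2) by blast
        have "x - u \<in> M" using xM u M by (simp add: subspace_diff)
        moreover have "S (x - u) = 0" using u by (simp add: S.diff)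
        ultimately have "x - u \<in> span F" using *(4) by blast
        moreover have "norm (x - (x - u)) \<le> 1/8 * norm x"
        proof -
          have "norm u \<le> (K' * \<mu>) * norm x" using u(3) \<mu> by (simp add: Sx mult.assoc)
          moreover have "K' * \<mu> \<le> 1/8" using \<mu> K' by (simp add: field_simps)
          ultimately show ?thesis using mult_right_mono[of "K' * \<mu>" "1/8" "norm x"] by simp
        qed
        ultimately show ?thesis by blast
      qed
      obtain H where H: "finite H" "nullsp B = span H"
        using near_finite_dim_imp_finite_dim[OF sub *(3) near] by blast
      show ?thesis by (rule fin_dim_if_real[OF H]) (simp add: nullsp_def bcl_scaleC[OF bclB] cv.scale_zero_right)
    qed
    ultimately show "fredholm B" by (simp add: fredholm_eq)
  qed
qed

lemma b_fredholm_infinite_ascent_shift: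
  fixes S :: "'a::{complex_normed_vector, banach} \<Rightarrow> 'a"
  assumes S: "bcl S" and bf: "b_fredholm S" and inf: "\<not> finite_ascent S"
  shows "\<exists>e>0. \<forall>\<mu>. 0 < \<mu> \<longrightarrow> \<mu> < e \<longrightarrow> \<not> finite_ascent (shift S (complex_of_real \<mu>))"
proof -
  have bl: "bounded_linear S" using S by (rule bcl_bounded_linear)
  interpret S: bounded_linear S by fact
  obtain n F where *: "closed (range (S ^^ n))" "closed (S ` range (S ^^ n))"
    "finite F" "{x \<in> range (S ^^ n). S x = 0} = span F"
    by (rule b_fredholmE[OF S bf])
  define R where "R k = range (S ^^ (n + k))" for k
  have R: "closed (R k)" "subspace (R k)" for k
    unfolding R_def using closed_range_funpow[OF bl *] subspace_range_funpow[OF bl] by simp_all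
  have SR: "S ` R k = R (Suc k)" for k unfolding R_def image_range_funpow by simp
  have R_mono: "R j \<subseteq> R k" if "k \<le> j" for j k unfolding R_def using that by (intro range_funpow_mono) simp
  define H where "H = (\<Inter>k. R k)"
  have H: "closed H" "subspace H" unfolding H_def using R by (auto intro!: subspace_Inter)
  define N where "N k = {x \<in> R k. S x = 0}" for k
  have "subspace (N k)" for k
  proof -
    have "N k = R k \<inter> {x. S x = 0}" by (auto simp: N_def)
    then show ?thesis using R(2) linear_subspace_kernel[OF S.linear_axioms] by (simp add: subspace_inter)
  qed
  moreover have "N (Suc k) \<subseteq> N k" for k using R_mono[of k "Suc k"] by (auto simp: N_def)
  moreover have "N 0 \<subseteq> span F" using *(4) by (simp add: N_def R_def)
  ultimately obtain k where k: "\<And>j. j \<ge> k \<Longrightarrow> N j = N k"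
    using decreasing_subspaces_stabilize[of N F] *(3) by blast
  have in_H: "x \<in> H" if "\<And>j. j \<ge> k \<Longrightarrow> x \<in> R j" for x
    unfolding H_def using that R_mono by (metis INT_I linear subsetD)
  have NH: "x \<in> H" if "x \<in> N k" for x
  proof (rule in_H)
    show "x \<in> R j" if "j \<ge> k" for j using k[OF that] \<open>x \<in> N k\<close> by (auto simp: N_def)
  qed
  have SH: "S ` H \<subseteq> H"
  proof
    fix y assume "y \<in> S ` H"
    then obtain x where x: "y = S x" "\<And>j. x \<in> R j" unfolding H_def by blast
    have "y \<in> R (Suc j)" for j using x SR by blast
    then have "y \<in> R j" for j using R_mono[of j "Suc j"] by auto
    then show "y \<in> H" by (simp add: H_def)
  qed
  have onto: "\<exists>x\<in>H. \<exists>f\<in>span {}. y = S x + f" if y: "y \<in> H" for y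
  proof -
    have "y \<in> S ` R j" for j using y unfolding SR H_def by blast
    then have ex: "\<exists>x\<in>R j. y = S x" for j by blast
    then obtain x where x: "x \<in> R k" "y = S x" by blast
    \<comment> \<open>Another preimage \<open>z\<close> of \<open>y\<close> lies in
      \<open>R j\<close>, and \<open>x - z\<close> belongs to the stable kernel, which is itself
      contained in \<open>R j\<close>.\<close>
    have "x \<in> R j" if j: "j \<ge> k" for j
    proof -
      obtain z where z: "z \<in> R j" "y = S z" using ex by blast
      have "x - z \<in> N k"
        using x z R_mono[OF j] subspace_diff[OF R(2)[of k]] by (auto simp: N_def S.diff)
      then have "x - z \<in> R j" using k[OF j] by (auto simp: N_def)
      then show ?thesis using z subspace_add[OF R(2)[of j], of "x - z" z] by simp
    qed
    then have "x \<in> H" by (rule in_H)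
    then show ?thesis using x by (intro bexI[of _ x] bexI[of _ 0]) auto
  qed
  obtain x0 where x0: "x0 \<in> H" "x0 \<noteq> 0" "S x0 = 0"
  proof -
    \<comment> \<open>A vector that is new in the kernel of the power \<open>Suc (n + k)\<close> is
      sent by \<open>S ^^ (n + k)\<close> to a nonzero element of \<open>N k\<close>, hence of
      \<open>H\<close>.\<close>
    have "nullsp (S ^^ (n + k)) \<noteq> nullsp (S ^^ Suc (n + k))" using inf unfolding finite_ascent_def by blast
    moreover have "nullsp (S ^^ (n + k)) \<subseteq> nullsp (S ^^ Suc (n + k))" by (auto simp: nullsp_def S.zero)
    ultimately obtain x where "(S ^^ Suc (n + k)) x = 0" "(S ^^ (n + k)) x \<noteq> 0" unfolding nullsp_def by blast
    moreover then have "(S ^^ (n + k)) x \<in> N k" by (simp add: N_def R_def)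
    ultimately show ?thesis using that[of "(S ^^ (n + k)) x"] NH by simp
  qed
  obtain e K where e: "e > 0" "K > 0"
    "\<forall>B. bounded_linear B \<longrightarrow> B ` H \<subseteq> H \<longrightarrow> (\<forall>x\<in>H. norm (B x - S x) \<le> e * norm x)
      \<longrightarrow> (\<forall>y\<in>H. \<exists>x\<in>H. \<exists>f\<in>span {}. y = B x + f \<and> norm x \<le> K * norm y)"
    \<comment> \<open>With an empty complement, stability of codimension becomes stability of
      surjectivity on \<open>H\<close>.\<close>
    using complement_stable[OF bl H SH finite.emptyI empty_subsetI onto] by blast
  show ?thesis
  proof (intro exI[of _ "min e (1 / K)"] conjI allI impI notI)
    show "0 < min e (1 / K)" using e by simp
    fix \<mu> :: real assume \<mu>: "0 < \<mu>" "\<mu> < min e (1 / K)"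
    define B where "B = shift S (complex_of_real \<mu>)"
    have B: "B x = S x - \<mu> *\<^sub>R x" for x by (simp add: B_def shift_of_real)
    have blB: "bounded_linear B" unfolding B_def using S by (intro bcl_bounded_linear bcl_shift)
    have BH: "B ` H \<subseteq> H" using H SH unfolding B by (auto intro!: subspace_diff subspace_scale)
    have close: "\<forall>x\<in>H. norm (B x - S x) \<le> e * norm x" using \<mu> by (auto simp: B mult_right_mono)
    have ontoB: "\<exists>x\<in>H. y = B x \<and> norm x \<le> K * norm y" if "y \<in> H" for y
      using e(3)[rule_format, OF blB BH _ that] close by auto
    assume "finite_ascent B"
    then obtain m where m: "nullsp (B ^^ m) = nullsp (B ^^ Suc m)" unfolding finite_ascent_def by blast
    have "\<mu> *\<^sub>R x0 \<in> H" using x0 H by (simp add: subspace_scale)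
    \<comment> \<open>As \<open>B x0 = - \<mu> x0\<close>, adding a solution \<open>z\<close> of
      \<open>B z = \<mu> x0\<close> gives a kernel vector of \<open>B\<close>. It is nonzero because
      \<open>\<mu> < 1 / K\<close> makes \<open>z\<close> strictly shorter than
      \<open>x0\<close>.\<close>
    then obtain z where z: "z \<in> H" "\<mu> *\<^sub>R x0 = B z" "norm z \<le> K * norm (\<mu> *\<^sub>R x0)" using ontoB by blast
    define x where "x = x0 + z"
    have xH: "x \<in> H" using x0 z H by (simp add: x_def subspace_add)
    have Bx: "B x = 0"
    proof -
      have "B x = B x0 + B z" unfolding x_def by (rule linear_add[OF bounded_linear.linear[OF blB]])
      then show ?thesis using x0 z(2) by (simp add: B)
    qed
    have "x \<noteq> 0"
    proof
      assume "x = 0"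
      then have "norm x0 = norm z" by (simp add: x_def add_eq_0_iff2)
      also have "\<dots> \<le> (K * \<mu>) * norm x0" using z(3) \<mu>(1) by simp
      also have "\<dots> < 1 * norm x0" using x0 \<mu> e by (intro mult_strict_right_mono) (auto simp: field_simps)
      finally show False by simp
    qed
    \<comment> \<open>Surjectivity on \<open>H\<close> lifts the kernel vector \<open>x\<close>
      through \<open>m\<close> steps to some \<open>y\<close> with \<open>x = (B ^^ m) y\<close>;
      this \<open>y\<close> separates the kernels of \<open>B ^^ m\<close> and
      \<open>B ^^ Suc m\<close>.\<close>
    have pow: "\<exists>y\<in>H. w = (B ^^ j) y" if "w \<in> H" for w j
      using that
    proof (induction j arbitrary: w)
      case 0
      then show ?case by auto
    next
      case (Suc j)
      then obtain v where "v \<in> H" "w = B v" using ontoB by blast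
      then show ?case using Suc.IH[of v] by auto
    qed
    obtain y where y: "x = (B ^^ m) y" using pow[OF xH] by blast
    then have "y \<in> nullsp (B ^^ Suc m)" using Bx by (simp add: nullsp_def)
    then have "y \<in> nullsp (B ^^ m)" using m by simp
    then have "x = 0" using y by (simp add: nullsp_def)
    then show False using \<open>x \<noteq> 0\<close> by blast
  qed
qed

lemma b_fredholm_finite_ascent_imp_left_drazin:
  fixes S :: "'a::{complex_normed_vector, banach} \<Rightarrow> 'a"
  assumes S: "bcl S" and bf: "b_fredholm S" and asc: "finite_ascent S"
  shows "left_drazin S"
proof -
  obtain n F where *: "closed (range (S ^^ n))" "closed (S ` range (S ^^ n))"
    "finite F" "{x \<in> range (S ^^ n). S x = 0} = span F"
    by (rule b_fredholmE[OF S bf])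
  show ?thesis
    by (rule left_drazin_if_closed_range[OF S asc, of n], rule closed_range_funpow[OF bcl_bounded_linear[OF S] *])
qed

lemma fredholm_imp_b_fredholm: "fredholm S \<Longrightarrow> b_fredholm S"
  unfolding b_fredholm_def fredholm_def by (rule exI[of _ 0]) simp

section \<open>Passage between the two pairs of spectra\<close>

theorem theorem2p14:
  fixes T :: "'a::{complex_normed_vector, banach} \<Rightarrow> 'a"
  assumes "\<not> fin_dim (UNIV :: 'a set)"
    and "bcl T"
  shows "(ess_spec T \<subseteq> ub_spec T \<longleftrightarrow> bf_spec T \<subseteq> ld_spec T)
       \<and> (ub_spec T = ess_spec T \<longleftrightarrow> ld_spec T = bf_spec T)"
proof -
  let ?S = "\<lambda>l. shift T l"
  have bcl: "bcl (?S l)" for l using assms(2) by (rule bcl_shift)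
  have usb_f: "fredholm (?S l)"
    if "\<And>l. left_drazin (?S l) \<Longrightarrow> b_fredholm (?S l)" "upper_semi_browder (?S l)" for l
    using that upper_semi_browder_imp_left_drazin[OF bcl] fredholm_if_upper_semi_fredholm_b_fredholm[OF bcl]
    by (simp add: upper_semi_browder_def)
  have ld_bf: "b_fredholm (?S l)"
    if hyp: "\<And>l. upper_semi_browder (?S l) \<Longrightarrow> fredholm (?S l)" and ld: "left_drazin (?S l)" for l
  proof -
    obtain e where e: "e > 0" "\<And>\<mu>. 0 < \<mu> \<Longrightarrow> \<mu> < e \<Longrightarrow> upper_semi_browder (?S (l + complex_of_real \<mu>))
        \<and> (fredholm (?S (l + complex_of_real \<mu>)) \<longrightarrow> b_fredholm (?S l))"
      using left_drazin_perturbation[OF bcl ld] unfolding shift_shift by blast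
    \<comment> \<open>The hypothesis is used at the nearby point \<open>l + e / 2\<close>, where the
      operator is upper semi-Browder, and the resulting Fredholm property is carried back to
      \<open>l\<close>.\<close>
    show ?thesis using e(2)[of "e / 2"] e(1) hyp by simp
  qed
  have f_usb: "upper_semi_browder (?S l)"
    if "\<And>l. b_fredholm (?S l) \<Longrightarrow> left_drazin (?S l)" "fredholm (?S l)" for l
    using that fredholm_imp_b_fredholm[of "?S l"]
    by (simp add: fredholm_eq upper_semi_browder_def upper_semi_fredholm_def left_drazin_def)
  have bf_ld: "left_drazin (?S l)"
    if hyp: "\<And>l. fredholm (?S l) \<Longrightarrow> upper_semi_browder (?S l)" and bf: "b_fredholm (?S l)" for l
  proof (rule b_fredholm_finite_ascent_imp_left_drazin[OF bcl bf], rule ccontr)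
    assume inf: "\<not> finite_ascent (?S l)"
    obtain e1 where e1: "e1 > 0" "\<And>\<mu>. 0 < \<mu> \<Longrightarrow> \<mu> < e1 \<Longrightarrow> fredholm (?S (l + complex_of_real \<mu>))"
      using b_fredholm_imp_fredholm_shift[OF bcl bf] unfolding shift_shift by blast
    obtain e2 where e2: "e2 > 0" "\<And>\<mu>. 0 < \<mu> \<Longrightarrow> \<mu> < e2 \<Longrightarrow> \<not> finite_ascent (?S (l + complex_of_real \<mu>))"
      using b_fredholm_infinite_ascent_shift[OF bcl bf inf] unfolding shift_shift by blast
    \<comment> \<open>A common shift at which the operator is Fredholm but of infinite ascent,
      against the hypothesis.\<close>
    define \<mu> where "\<mu> = min e1 e2 / 2"
    have "0 < \<mu>" "\<mu> < e1" "\<mu> < e2" using e1 e2 by (auto simp: \<mu>_def)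
    then show False using hyp[OF e1(2)[of \<mu>]] e2(2)[of \<mu>] by (simp add: upper_semi_browder_def)
  qed
  have 1: "ess_spec T \<subseteq> ub_spec T \<longleftrightarrow> bf_spec T \<subseteq> ld_spec T"
    unfolding ess_spec_def ub_spec_def bf_spec_def ld_spec_def using usb_f ld_bf by blast
  \<comment> \<open>The reverse inclusions are equivalent as well, and the two equivalences together
    give the one between equalities.\<close>
  have "ub_spec T \<subseteq> ess_spec T \<longleftrightarrow> ld_spec T \<subseteq> bf_spec T"
    unfolding ess_spec_def ub_spec_def bf_spec_def ld_spec_def using f_usb bf_ld by blast
  then show ?thesis using 1 by blast
qed

end
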